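(* Let $\mathcal X$ and $\mathcal Y_i$, $i=0,\dots,N-1$, be reflexive Banach spaces with each $\mathcal Y_i$ uniformly smooth, and let $\Theta$ and $F_i$, $i=0,\dots,N-1$, satisfy assumption (A1) of the context, and $S_\varepsilon$ assumption (A2). Let $\{\varepsilon_n\}_{n\ge0}$ be a sequence of positive numbers with $16\sum_{n=0}^\infty\varepsilon_n\le c_0\rho^p$. Let $\beta>1$ be a constant with $\beta\gamma<1$, let $\beta_1>0$, let $\beta_0>0$ and $\tau>1$ be such that $$\frac1\beta-\gamma-\frac{1+\gamma}{\tau}-\frac2{p^*}\Big(\frac{\beta_0}{2c_0}\Big)^{p^*-1}>0,$$ and let $\sigma>0$ be such that $\kappa\beta_1\sigma\le1$, where $\kappa=1$ if $p\ge s$ and $\kappa=(\beta^{\frac p{s-p}}-1)^{\frac{p-s}p}$ if $p<s$. Let $\delta>0$ and let $y_i^\delta\in\mathcal Y_i$ satisfy $\|y_i^\delta-y_i\|\le\delta$, $i=0,\dots,N-1$. Then for the Landweber-Kaczmarz method with noisy data described in the context there hold: (i) $x_n^\delta\in B_{2\rho}(x_0)\cap\mathscr D(\Theta)$ for all $n=0,1,\dots$; (ii) the method terminates after $n_\delta<\infty$ iteration steps; (iii) for any solution $\hat x$ of the system $F_i(x)=y_i$, $i=0,\dots,N-1$, in $B_{2\rho}(x_0)\cap\mathscr D(\Theta)$ there holds $$D^{\varepsilon_{n+1}}_{\xi^\delta_{n+1}}\Theta(\hat x,x^\delta_{n+1})-D^{\varepsilon_n}_{\xi^\delta_n}\Theta(\hat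 x,x_n^\delta)\le2\varepsilon_n+\varepsilon_{n+1}\qquad\text{for all }n\ge0.$$ Here one may also take $\varepsilon_0=0$ (because $\xi_0\in\partial\Theta(x_0)$), i.e. the inequality still holds if $\varepsilon_0=0$ is used in the method and in (iii), with $\varepsilon_n>0$ for $n\ge1$.
   Context: All Banach spaces are real; $\mathcal X^*$ is the dual, $\langle\xi,x\rangle=\xi(x)$ for $\xi\in\mathcal X^*$, $x\in\mathcal X$. $B_r(x_0)=\{x\in\mathcal X:\|x-x_0\|\le r\}$. For $\Theta:\mathcal X\to(-\infty,\infty]$, $\mathscr D(\Theta)=\{x:\Theta(x)<\infty\}$. For $\varepsilon\ge0$, the $\varepsilon$-subdifferential is $\partial_\varepsilon\Theta(x)=\{\xi\in\mathcal X^*:\Theta(\bar x)\ge\Theta(x)+\langle\xi,\bar x-x\rangle-\varepsilon\ \forall\bar x\in\mathcal X\}$, and $\partial\Theta=\partial_0\Theta$. For $\xi\in\partial_\varepsilon\Theta(x)$ the $\varepsilon$-Bregman distance is $D^\varepsilon_\xi\Theta(\bar x,x)=\Theta(\bar x)-\Theta(x)-\langle\xi,\bar x-x\rangle+\varepsilon$; $D_\xi\Theta=D^0_\xi\Theta$. $\Theta$ is $p$-convex ($p\ge2$) with constant $c_0>0$ if $\Theta(t\bar x+(1-t)x)+c_0t(1-t)\|\bar x-x\|^p\le t\Theta(\bar x)+(1-t)\Theta(x)$ for all $0\le t\le1$, $\bar x,x\in\mathcal X$. $p^*$ is the conjugate exponent, $1/p+1/p^*=1$. For $1<s<\infty$ fixed,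 $J_s^{\mathcal Y_i}(y)=\{\zeta\in\mathcal Y_i^*:\|\zeta\|=\|y\|^{s-1},\ \langle\zeta,y\rangle=\|y\|^s\}$ is the duality mapping, single valued since $\mathcal Y_i$ is uniformly smooth. Problem: $F_i(x)=y_i$, $i=0,\dots,N-1$, with $F_i:\mathscr D(F_i)\subset\mathcal X\to\mathcal Y_i$; put $\mathscr D=\bigcap_{i=0}^{N-1}\mathscr D(F_i)$. Assumption (A1): (a) $\Theta:\mathcal X\to(-\infty,\infty]$ is proper, lower semi-continuous and $p$-convex with constant $c_0$. (b) There exist $\rho>0$, $x_0\in\mathcal X$, $\xi_0\in\partial\Theta(x_0)$ such that $B_{2\rho}(x_0)\subset\mathscr D$ and the system has a solution $x^\dagger\in\mathscr D(\Theta)$ with $D_{\xi_0}\Theta(x^\dagger,x_0)\le\frac14c_0\rho^p$. (c) For each $i$ there is a family of bounded linear operators $L_i(x):\mathcal X\to\mathcal Y_i$, $x\in B_{2\rho}(x_0)$, such that $x\mapsto L_i(x)$ is continuous on $B_{2\rho}(x_0)$ (operator norm), and there is $0\le\gamma<1$ with $\|F_i(\bar x)-F_i(x)-L_i(x)(\bar x-x)\|\le\gamma\|F_i(\bar x)-F_i(x)\|$ for all $\bar x,x\in B_{2\rho}(x_0)$ and all $i$. Assumption (A2): for each $\varepsilon>0$, $S_\varepsilon:\mathcal X^*\to\mathcal X$ is a continuous mapping such that for every $\xi\in\mathcal X^*$, $x=S_\varepsilon(\xi)$ satisfies $\Theta(x)-\langle\xi,x\rangle\le\min_{z\in\mathcal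 X}\{\Theta(z)-\langle\xi,z\rangle\}+\varepsilon$. Landweber-Kaczmarz method with noisy data: set $x_0^\delta=x_0$, $\xi_0^\delta=\xi_0$ (those of (A1)(b)), $q_{-1}=0$, $i_n=n\ (\mathrm{mod}\ N)$. For $n\ge0$ let $r_n^\delta=F_{i_n}(x_n^\delta)-y_{i_n}^\delta$; $q_n=q_{n-1}+1$ if $\|r_n^\delta\|^p+\sigma\varepsilon_n\le(\tau\delta)^p$, and $q_n=0$ otherwise; $$\tilde\mu_n^\delta=\min\Big\{\frac{\beta_0\|r_n^\delta\|^{p(s-1)}}{\|L_{i_n}(x_n^\delta)^*J_s^{\mathcal Y_{i_n}}(r_n^\delta)\|^p},\beta_1\Big\}$$ (with $\tilde\mu_n^\delta=\beta_1$ when the denominator is zero); $\mu_n^\delta=\tilde\mu_n^\delta(\|r_n^\delta\|^p+\sigma\varepsilon_n)^{1-\frac sp}$ if $\|r_n^\delta\|^p+\sigma\varepsilon_n>(\tau\delta)^p$, and $\mu_n^\delta=0$ otherwise; and $$\xi_{n+1}^\delta=\xi_n^\delta-\mu_n^\delta L_{i_n}(x_n^\delta)^*J_s^{\mathcal Y_{i_n}}(r_n^\delta),\qquad x_{n+1}^\delta=S_{\varepsilon_{n+1}}(\xi_{n+1}^\delta).$$ The iterates are considered for all $n\ge0$; the stopping index $n_\delta$ (termination) is the first integer with $q_{n_\delta}=N$. By construction $\xi_n^\delta\in\partial_{\varepsilon_n}\Theta(x_n^\delta)$. *)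

theory Defs
  imports "HOL-Analysis.Analysis"
begin

section \<open>Banach spaces given as complete subspaces\<close>

text \<open>
  A finite family of different Banach spaces cannot be given by a family of types. It is
  represented by complete linear subspaces \<open>V\<close> of one normed space, with the induced norm. This
  loses no generality: finitely many Banach spaces embed isometrically in their direct sum
  normed by the Euclidean combination of the norms.

  A functional on \<open>V\<close> is represented by its extension by zero off \<open>V\<close>, so that functionals that
  agree on \<open>V\<close> are equal. A single space is the case \<open>V = UNIV\<close>.
\<close>

definition dual_space :: "'a::real_normed_vector set \<Rightarrow> ('a \<Rightarrow> real) set" where
  "dual_space V = {f. (\<forall>u\<in>V. \<forall>v\<in>V. f (u + v) = f u + f v) \<and>
                      (\<forall>c. \<forall>v\<in>V. f (c *\<^sub>R v) = c * f v) \<and>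
                      (\<exists>C. \<forall>v\<in>V. \<bar>f v\<bar> \<le> C * norm v) \<and>
                      (\<forall>v. v \<notin> V \<longrightarrow> f v = 0)}"

definition dual_norm :: "'a::real_normed_vector set \<Rightarrow> ('a \<Rightarrow> real) \<Rightarrow> real" where
  "dual_norm V f = (SUP v\<in>{v \<in> V. norm v \<le> 1}. \<bar>f v\<bar>)"

definition reflexive_on :: "'a::real_normed_vector set \<Rightarrow> bool" where
  "reflexive_on V \<longleftrightarrow>
     (\<forall>\<Phi> :: ('a \<Rightarrow> real) \<Rightarrow> real.
        (\<forall>f\<in>dual_space V. \<forall>g\<in>dual_space V. \<Phi> (\<lambda>v. f v + g v) = \<Phi> f + \<Phi> g) \<and>
        (\<forall>c. \<forall>f\<in>dual_space V. \<Phi> (\<lambda>v. c * f v) = c * \<Phi> f) \<and>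
        (\<exists>C. \<forall>f\<in>dual_space V. \<bar>\<Phi> f\<bar> \<le> C * dual_norm V f)
        \<longrightarrow> (\<exists>v\<in>V. \<forall>f\<in>dual_space V. \<Phi> f = f v))"

text \<open>
  Inserting \<open>0\<close> matters only when \<open>V\<close> has no unit vector, that is \<open>V = {0}\<close>; otherwise \<open>w = 0\<close>
  already contributes the value \<open>0\<close>.
\<close>

definition modulus_of_smoothness :: "'a::real_normed_vector set \<Rightarrow> real \<Rightarrow> real" where
  "modulus_of_smoothness V t =
     Sup (insert 0 {(norm (v + w) + norm (v - w)) / 2 - 1 | v w.
                      v \<in> V \<and> w \<in> V \<and> norm v = 1 \<and> norm w \<le> t})"

definition uniformly_smooth_on :: "'a::real_normed_vector set \<Rightarrow> bool" where
  "uniformly_smooth_on V \<longleftrightarrow> ((\<lambda>t. modulus_of_smoothness V t / t) \<longlongrightarrow> 0) (at_right 0)"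

definition duality_mapping :: "real \<Rightarrow> 'a::real_normed_vector set \<Rightarrow> 'a \<Rightarrow> ('a \<Rightarrow> real) set" where
  "duality_mapping s V v =
     {\<zeta> \<in> dual_space V. dual_norm V \<zeta> = norm v powr (s - 1) \<and> \<zeta> v = norm v powr s}"

text \<open>The duality mapping as a function, for uniformly smooth \<open>V\<close>, where it is single valued.\<close>

definition duality_map :: "real \<Rightarrow> 'a::real_normed_vector set \<Rightarrow> 'a \<Rightarrow> ('a \<Rightarrow> real)" where
  "duality_map s V v = (THE \<zeta>. \<zeta> \<in> duality_mapping s V v)"

text \<open>
  \<open>L\<^sup>* \<zeta>\<close> for \<open>\<zeta> \<in> dual_space V\<close>, where \<open>L\<close> takes its values in \<open>V\<close>.
\<close>

definition adjoint_apply ::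
    "('x::real_normed_vector \<Rightarrow>\<^sub>L 'y::real_normed_vector) \<Rightarrow> ('y \<Rightarrow> real) \<Rightarrow> ('x \<Rightarrow>\<^sub>L real)" where
  "adjoint_apply L \<zeta> = Blinfun (\<lambda>h. \<zeta> (blinfun_apply L h))"


section \<open>Extended-real valued convex functions\<close>

definition effective_domain :: "('x \<Rightarrow> ereal) \<Rightarrow> 'x set" where
  "effective_domain \<Theta> = {x. \<Theta> x < \<infinity>}"

definition proper_fun :: "('x \<Rightarrow> ereal) \<Rightarrow> bool" where
  "proper_fun \<Theta> \<longleftrightarrow> (\<forall>x. \<Theta> x \<noteq> -\<infinity>) \<and> effective_domain \<Theta> \<noteq> {}"

definition lower_semicontinuous :: "('x::topological_space \<Rightarrow> ereal) \<Rightarrow> bool" where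
  "lower_semicontinuous \<Theta> \<longleftrightarrow> (\<forall>x. \<Theta> x \<le> Liminf (at x) \<Theta>)"

text \<open>Note that \<open>0 * \<infinity> = 0\<close> in \<^typ>\<open>ereal\<close>, so the cases \<open>t = 0\<close> and \<open>t = 1\<close> are trivial.\<close>

definition p_convex :: "real \<Rightarrow> real \<Rightarrow> ('x::real_normed_vector \<Rightarrow> ereal) \<Rightarrow> bool" where
  "p_convex p c\<^sub>0 \<Theta> \<longleftrightarrow>
     (\<forall>t xb x. 0 \<le> t \<and> t \<le> 1 \<longrightarrow>
        \<Theta> (t *\<^sub>R xb + (1 - t) *\<^sub>R x) + ereal (c\<^sub>0 * t * (1 - t) * norm (xb - x) powr p)
          \<le> ereal t * \<Theta> xb + ereal (1 - t) * \<Theta> x)"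

definition eps_subdifferential ::
    "real \<Rightarrow> ('x::real_normed_vector \<Rightarrow> ereal) \<Rightarrow> 'x \<Rightarrow> ('x \<Rightarrow>\<^sub>L real) set" where
  "eps_subdifferential e \<Theta> x =
     {\<xi>. \<forall>xb. \<Theta> xb \<ge> \<Theta> x + ereal (blinfun_apply \<xi> (xb - x)) - ereal e}"

abbreviation subdifferential ::
    "('x::real_normed_vector \<Rightarrow> ereal) \<Rightarrow> 'x \<Rightarrow> ('x \<Rightarrow>\<^sub>L real) set" where
  "subdifferential \<equiv> eps_subdifferential 0"

text \<open>\<open>eps_bregman e \<xi> \<Theta> xb x\<close> is the \<open>e\<close>-Bregman distance from \<open>x\<close> to \<open>xb\<close>.\<close>

definition eps_bregman ::
    "real \<Rightarrow> ('x::real_normed_vector \<Rightarrow>\<^sub>L real) \<Rightarrow> ('x \<Rightarrow> ereal) \<Rightarrow> 'x \<Rightarrow> 'x \<Rightarrow> ereal" where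
  "eps_bregman e \<xi> \<Theta> xb x = \<Theta> xb - \<Theta> x - ereal (blinfun_apply \<xi> (xb - x)) + ereal e"

end

theory Submission
  imports Defs
begin

text \<open>
  The argument is a monotonicity argument for the Bregman distance from the iterates to a fixed
  solution. Passing from \<open>x n\<close> to \<open>x (Suc n)\<close> changes this distance by three contributions: the
  pairing of the dual update with \<open>x n - xh\<close>, which is the residual term and drives the decrease;
  the coupling of the dual update with the primal movement \<open>x (Suc n) - x n\<close>; and a gain from
  \<open>p\<close>-convexity that absorbs the coupling (\<open>eps_bregman_step\<close>). The cone condition and
  the properties of the duality mapping turn the first one into a multiple of
  \<open>norm (r n) powr s\<close>, up to the nonlinearity and the noise (\<open>duality_mapping_pairing\<close>). The
  inequality between the parameters ensures that what remains is a net decrease by a positive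
  multiple of \<open>\<mu>t n * R n\<close>, where \<open>R n = norm (r n) powr p + \<sigma> * \<epsilon> n\<close>, apart from errors of the order
  of \<open>\<epsilon> n\<close> and \<open>\<epsilon> (Suc n)\<close> (\<open>landweber_step_decrease\<close>).

  The iterates cannot leave the ball, because \<open>p\<close>-convexity makes the Bregman distance to \<open>xdag\<close>
  dominate the norm distance, and its initial value together with all errors is too
  small for more than \<open>\<rho>\<close>. A step is skipped, with \<open>\<mu> n = 0\<close>, when the residual is at noise
  level. Since the decreases are summable and every step that is not skipped contributes at least
  a fixed amount, only finitely many steps are not skipped; after that the counter runs up to \<open>N\<close>.

  Two points need an argument of their own. The fixed amount requires a bound for the operators
  \<open>L i (x n)\<close>; continuity alone gives none on a ball of infinite dimension, but the cone condition
  does (\<open>tangential_cone_bounded_derivative\<close>). And the duality mapping must be shown to be single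
  valued and nonempty (\<open>duality_map_in_duality_mapping\<close>); for a uniformly smooth space both follow
  from the differentiability of the norm, the derivative of the norm being the norming functional.
\<close>

section \<open>The duality mapping of a uniformly smooth space\<close>

lemma dual_norm_bound:
  assumes V: "subspace V" and f: "f \<in> dual_space V" and v: "v \<in> V"
  shows "\<bar>f v\<bar> \<le> dual_norm V f * norm v"
proof (cases "v = 0")
  case True
  then have "f v = 0" using f V unfolding dual_space_def
    by (metis (mono_tags, lifting) mem_Collect_eq mult_zero_left scaleR_zero_left subspace_0)
  then show ?thesis using True by simp
next
  case False
  obtain C where C: "\<forall>u\<in>V. \<bar>f u\<bar> \<le> C * norm u"
    using f by (auto simp: dual_space_def)
  define u where "u = (1 / norm v) *\<^sub>R v"
  have u: "u \<in> V" "norm u \<le> 1"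
    using V v False by (auto simp: u_def subspace_scale)
  have "bdd_above ((\<lambda>v. \<bar>f v\<bar>) ` {v \<in> V. norm v \<le> 1})"
  proof (rule bdd_aboveI2)
    fix w assume w: "w \<in> {v \<in> V. norm v \<le> 1}"
    have "\<bar>f w\<bar> \<le> \<bar>C\<bar> * norm w"
      using C w by (smt (verit) mem_Collect_eq mult_right_mono norm_ge_zero)
    also have "\<dots> \<le> \<bar>C\<bar>" using w by (simp add: mult_left_le)
    finally show "\<bar>f w\<bar> \<le> \<bar>C\<bar>" .
  qed
  then have "\<bar>f u\<bar> \<le> dual_norm V f"
    unfolding dual_norm_def using u by (intro cSUP_upper) auto
  moreover have "f u = (1 / norm v) * f v"
    using f v by (simp add: dual_space_def u_def)
  ultimately show ?thesis using False by (simp add: field_simps abs_mult)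
qed

text \<open>
  Uniform smoothness enters only through this pointwise consequence: after normalising
  \<open>v\<close>, the second difference of the norm is bounded by the modulus of smoothness at
  \<open>t * norm w / norm v\<close>, and that modulus is \<open>o(t)\<close>.
\<close>

lemma uniformly_smooth_second_difference:
  assumes V: "subspace V" and sm: "uniformly_smooth_on V" and v: "v \<in> V" and w: "w \<in> V" "v \<noteq> 0"
  shows "((\<lambda>t. (norm (v + t *\<^sub>R w) + norm (v - t *\<^sub>R w) - 2 * norm v) / t) \<longlongrightarrow> 0) (at_right 0)"
proof (cases "w = 0")
  case True
  then show ?thesis by (auto intro: tendsto_eq_intros)
next
  case False
  define k where "k = norm w / norm v"
  have k: "k > 0" using False w by (simp add: k_def)
  have lim: "((\<lambda>t. modulus_of_smoothness V (t * k) / (t * k)) \<longlongrightarrow> 0) (at_right 0)"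
  proof -
    have "filterlim (\<lambda>t. t * k) (at_right 0) (at_right 0)"
      unfolding filterlim_at
    proof
      show "((\<lambda>t. t * k) \<longlongrightarrow> 0) (at_right 0)" by (auto intro: tendsto_eq_intros)
      show "\<forall>\<^sub>F t in at_right 0. t * k \<in> {0<..} \<and> t * k \<noteq> 0"
        using k by (auto intro!: eventually_mono[OF eventually_at_right_less])
    qed
    with sm show ?thesis
      unfolding uniformly_smooth_on_def by (rule filterlim_compose)
  qed
  have up: "((\<lambda>t. 2 * norm w * (modulus_of_smoothness V (t * k) / (t * k))) \<longlongrightarrow> 0) (at_right 0)"
    using tendsto_mult_right_zero[OF lim] by blast
  show ?thesis
  proof (rule real_tendsto_sandwich[OF _ _ tendsto_const up])
    have "2 * norm v = norm ((v + t *\<^sub>R w) + (v - t *\<^sub>R w))" for t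
      by (simp flip: scaleR_2)
    then have "2 * norm v \<le> norm (v + t *\<^sub>R w) + norm (v - t *\<^sub>R w)" for t
      using norm_triangle_ineq by metis
    then show "\<forall>\<^sub>F t in at_right 0.
        0 \<le> (norm (v + t *\<^sub>R w) + norm (v - t *\<^sub>R w) - 2 * norm v) / t"
      by (auto intro!: eventually_mono[OF eventually_at_right_less] divide_nonneg_pos)
    have "(norm (v + t *\<^sub>R w) + norm (v - t *\<^sub>R w) - 2 * norm v) / t
            \<le> 2 * norm w * (modulus_of_smoothness V (t * k) / (t * k))" if t: "t > 0" for t
    proof -
      define a where "a = (1 / norm v) *\<^sub>R v"
      define b where "b = (t / norm v) *\<^sub>R w"
      define A where "A = {(norm (v + w) + norm (v - w)) / 2 - 1 | v w.
                      v \<in> V \<and> w \<in> V \<and> norm v = 1 \<and> norm w \<le> t * k}"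
      have ab: "a \<in> V" "b \<in> V" "norm a = 1" "norm b \<le> t * k"
        using V v w t by (auto simp: a_def b_def k_def subspace_scale)
      have "bdd_above A"
      proof (rule bdd_aboveI[of _ "t * k"])
        fix z assume "z \<in> A"
        then have "\<exists>a b. z = (norm (a + b) + norm (a - b)) / 2 - 1 \<and> a \<in> V \<and> b \<in> V
            \<and> norm a = 1 \<and> norm b \<le> t * k"
          unfolding A_def by (rule CollectD)
        then obtain a b where "z = (norm (a + b) + norm (a - b)) / 2 - 1 \<and> a \<in> V \<and> b \<in> V
            \<and> norm a = 1 \<and> norm b \<le> t * k"
          by (elim exE)
        then show "z \<le> t * k"
          using norm_triangle_ineq[of a b] norm_triangle_ineq4[of a b] by argo
      qed
      then have "(norm (a + b) + norm (a - b)) / 2 - 1 \<le> modulus_of_smoothness V (t * k)"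
        unfolding modulus_of_smoothness_def A_def[symmetric]
        by (intro cSup_upper) (use ab in \<open>auto simp: A_def\<close>)
      moreover have "a + b = (1 / norm v) *\<^sub>R (v + t *\<^sub>R w)" "a - b = (1 / norm v) *\<^sub>R (v - t *\<^sub>R w)"
        by (simp_all add: a_def b_def scaleR_add_right scaleR_diff_right)
      then have "norm (a + b) = norm (v + t *\<^sub>R w) / norm v" "norm (a - b) = norm (v - t *\<^sub>R w) / norm v"
        by simp_all
      ultimately have "(norm (v + t *\<^sub>R w) + norm (v - t *\<^sub>R w) - 2 * norm v)
          \<le> 2 * norm v * modulus_of_smoothness V (t * k)"
        using w by (simp add: field_simps)
      then have "(norm (v + t *\<^sub>R w) + norm (v - t *\<^sub>R w) - 2 * norm v) / t
          \<le> 2 * norm v * modulus_of_smoothness V (t * k) / t"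
        using t by (simp add: divide_right_mono)
      also have "\<dots> = 2 * norm w * (modulus_of_smoothness V (t * k) / (t * k))"
        using w False t by (simp add: k_def)
      finally show ?thesis .
    qed
    then show "\<forall>\<^sub>F t in at_right 0. (norm (v + t *\<^sub>R w) + norm (v - t *\<^sub>R w) - 2 * norm v) / t
            \<le> 2 * norm w * (modulus_of_smoothness V (t * k) / (t * k))"
      by (auto intro!: eventually_mono[OF eventually_at_right_less])
  qed
qed

text \<open>
  Since the difference quotient of the convex function \<open>t \<mapsto> norm (v + t w)\<close> increases with
  \<open>t\<close>, the infimum is the one-sided directional derivative of the norm at \<open>v\<close>. Taking it as an
  infimum makes it exist without any smoothness.
\<close>

definition norm_derivative :: "'a::real_normed_vector \<Rightarrow> 'a \<Rightarrow> real" where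
  "norm_derivative v w = (INF t\<in>{0<..}. (norm (v + t *\<^sub>R w) - norm v) / t)"

text \<open>
  The one-sided derivative of a norm is sublinear. Subadditivity combines the midpoint convexity of
  the norm with the monotonicity of the quotients: two quotients with different steps are compared
  at their smaller step, and the sum of the directions is taken at half of that step.
\<close>

lemma norm_derivative_properties:
  fixes v :: "'a::real_normed_vector"
  shows norm_derivative_le:
      "\<And>t w. t > 0 \<Longrightarrow> norm_derivative v w \<le> (norm (v + t *\<^sub>R w) - norm v) / t"
    and norm_derivative_bound: "\<And>w. \<bar>norm_derivative v w\<bar> \<le> norm w"
    and norm_derivative_subadditive:
      "\<And>w w'. norm_derivative v (w + w') \<le> norm_derivative v w + norm_derivative v w'"
    and norm_derivative_scale:
      "\<And>c w. c > 0 \<Longrightarrow> norm_derivative v (c *\<^sub>R w) = c * norm_derivative v w"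
    and norm_derivative_self: "norm_derivative v v = norm v"
proof -
  define q where "q = (\<lambda>t w. (norm (v + t *\<^sub>R w) - norm v) / t)"
  define d where "d = norm_derivative v"
  have d_INF: "d w = (INF t\<in>{0<..}. q t w)" for w
    by (simp add: d_def norm_derivative_def q_def)
  have lo: "- norm w \<le> q t w" if "t > 0" for t w
    using that norm_triangle_ineq4[of "v + t *\<^sub>R w" "t *\<^sub>R w"] by (simp add: q_def field_simps)
  have up: "q t w \<le> norm w" if "t > 0" for t w
    using that norm_triangle_ineq[of "v" "t *\<^sub>R w"] by (simp add: q_def field_simps)
  have bdd: "bdd_below ((\<lambda>t. q t w) ` {0<..})" for w
    using lo by (intro bdd_belowI2) auto
  have le: "d w \<le> q t w" if "t > 0" for t w
    unfolding d_INF using that bdd by (intro cINF_lower) auto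
  have ge: "b \<le> d w" if "\<And>t. t > 0 \<Longrightarrow> b \<le> q t w" for b w
    unfolding d_INF using that by (intro cINF_greatest) auto
  show "norm_derivative v w \<le> (norm (v + t *\<^sub>R w) - norm v) / t" if "t > 0" for t w
    using le[OF that] by (simp add: d_def q_def)
  show "\<bar>norm_derivative v w\<bar> \<le> norm w" for w
    unfolding d_def[symmetric] using ge[of "- norm w" w] lo le[of 1 w] up[of 1 w] by fastforce
  show "norm_derivative v (c *\<^sub>R w) = c * norm_derivative v w" if c: "c > 0" for c w
    unfolding d_def[symmetric]
  proof -
    have *: "c * d w \<le> d (c *\<^sub>R w)" if c: "c > 0" for c w
    proof (rule ge)
      fix t :: real assume t: "t > 0"
      have "q t (c *\<^sub>R w) = c * q (t * c) w" using c t by (simp add: q_def)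
      then show "c * d w \<le> q t (c *\<^sub>R w)" using le[of "t * c" w] c t by simp
    qed
    have "(1 / c) * d (c *\<^sub>R w) \<le> d w"
      using *[of "1 / c" "c *\<^sub>R w"] c by simp
    then show "d (c *\<^sub>R w) = c * d w" using *[OF c, of w] c by (simp add: field_simps)
  qed
  have mono: "q s w \<le> q t w" if "0 < s" "s \<le> t" for s t w
  proof -
    have "v + s *\<^sub>R w = (1 - s / t) *\<^sub>R v + (s / t) *\<^sub>R (v + t *\<^sub>R w)"
      using that by (simp add: algebra_simps)
    then have "norm (v + s *\<^sub>R w) \<le> (1 - s / t) * norm v + (s / t) * norm (v + t *\<^sub>R w)"
      using that norm_triangle_ineq[of "(1 - s / t) *\<^sub>R v" "(s / t) *\<^sub>R (v + t *\<^sub>R w)"] by simp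
    then show ?thesis using that by (simp add: q_def field_simps)
  qed
  show "norm_derivative v (w + w') \<le> norm_derivative v w + norm_derivative v w'" for w w'
    unfolding d_def[symmetric]
  proof -
    have "d (w + w') \<le> q s w + q t w'" if s: "s > 0" and t: "t > 0" for s t
    proof -
      define m where "m = min s t"
      have m: "m > 0" using s t by (simp add: m_def)
      have "v + (m / 2) *\<^sub>R (w + w') = (1 / 2) *\<^sub>R ((v + m *\<^sub>R w) + (v + m *\<^sub>R w'))"
        by (simp add: algebra_simps flip: scaleR_2)
      then have "norm (v + (m / 2) *\<^sub>R (w + w')) \<le> (norm (v + m *\<^sub>R w) + norm (v + m *\<^sub>R w')) / 2"
        using norm_triangle_ineq[of "v + m *\<^sub>R w" "v + m *\<^sub>R w'"] by simp
      then have "(norm (v + (m / 2) *\<^sub>R (w + w')) - norm v) / (m / 2)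
          \<le> (((norm (v + m *\<^sub>R w) - norm v) + (norm (v + m *\<^sub>R w') - norm v)) / 2) / (m / 2)"
        using m by (intro divide_right_mono) auto
      then have "(norm (v + (m / 2) *\<^sub>R (w + w')) - norm v) / (m / 2)
          \<le> ((norm (v + m *\<^sub>R w) - norm v) + (norm (v + m *\<^sub>R w') - norm v)) / m"
        by (simp only: divide_divide_eq_left)
      then have "q (m / 2) (w + w') \<le> q m w + q m w'"
        unfolding q_def add_divide_distrib by (simp only:)
      with le[of "m / 2" "w + w'"] mono[of m s w] mono[of m t w'] m show ?thesis
        by (simp add: m_def)
    qed
    then have "d (w + w') - q s w \<le> d w'" if "s > 0" for s
      using that by (intro ge) (smt (verit))
    then have "d (w + w') - d w' \<le> d w"
      by (intro ge) (smt (verit))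
    then show "d (w + w') \<le> d w + d w'" by simp
  qed
  have "q t v = norm v" if "t > 0" for t
  proof -
    have "v + t *\<^sub>R v = (1 + t) *\<^sub>R v" by (simp add: algebra_simps)
    then have "norm (v + t *\<^sub>R v) = \<bar>1 + t\<bar> * norm v" by (simp only: norm_scaleR)
    then show ?thesis using that by (simp add: q_def field_simps)
  qed
  then show "norm_derivative v v = norm v"
    unfolding d_def[symmetric] using ge[of "norm v" v] le[of 1 v] by force
qed

text \<open>
  In a smooth space the norming functional is the derivative of the norm: smoothness makes the
  sublinear directional derivative of the norm odd on \<open>V\<close>, hence linear, and it takes the value
  \<open>norm v\<close> in the direction \<open>v\<close>.
\<close>

lemma uniformly_smooth_norming_functional:
  assumes V: "subspace V" and sm: "uniformly_smooth_on V" and v: "v \<in> V" "v \<noteq> 0"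
  obtains f where "f \<in> dual_space V" "f v = norm v" "\<And>w. w \<in> V \<Longrightarrow> \<bar>f w\<bar> \<le> norm w"
proof -
  define d where "d = norm_derivative v"
  note dd = norm_derivative_properties[where v=v, folded d_def]
  note sub = norm_derivative_subadditive[of v, folded d_def]
  have d0: "d 0 = 0" using dd(2)[of 0] by simp
  have neg: "d (- w) = - d w" if w: "w \<in> V" for w
  proof -
    have "d w + d (- w) \<le> 0"
    proof (rule tendsto_lowerbound)
      show "((\<lambda>t. (norm (v + t *\<^sub>R w) + norm (v - t *\<^sub>R w) - 2 * norm v) / t) \<longlongrightarrow> 0) (at_right 0)"
        by (rule uniformly_smooth_second_difference[OF V sm v(1) w v(2)])
      have "d w + d (- w) \<le> (norm (v + t *\<^sub>R w) + norm (v - t *\<^sub>R w) - 2 * norm v) / t"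
        if "t > 0" for t
        using dd(1)[OF that, of w] dd(1)[OF that, of "- w"] that by (simp add: field_simps)
      then show "\<forall>\<^sub>F t in at_right 0.
          d w + d (- w) \<le> (norm (v + t *\<^sub>R w) + norm (v - t *\<^sub>R w) - 2 * norm v) / t"
        by (auto intro!: eventually_mono[OF eventually_at_right_less])
    qed auto
    with sub[of w "- w"] d0 show ?thesis by simp
  qed
  have add: "d (w + w') = d w + d w'" if "w \<in> V" "w' \<in> V" for w w'
    using sub[of w w'] sub[of "w + w'" "- w'"] neg[OF that(2)] by simp
  have scale: "d (c *\<^sub>R w) = c * d w" if w: "w \<in> V" for c w
  proof -
    consider "c = 0" | "c > 0" | "c < 0" by linarith
    then show ?thesis
    proof cases
      case 3
      then have "d ((- c) *\<^sub>R w) = - c * d w" by (intro dd(4)) simp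
      then show ?thesis using neg[of "c *\<^sub>R w"] w V by (simp add: subspace_scale)
    qed (auto simp: d0 dd(4))
  qed
  show thesis
  proof (rule that[of "\<lambda>w. if w \<in> V then d w else 0"])
    show "(\<lambda>w. if w \<in> V then d w else 0) \<in> dual_space V"
      unfolding dual_space_def using V dd(2)
      by (auto simp: add scale subspace_add subspace_scale intro!: exI[of _ 1])
  qed (use v dd in auto)
qed

text \<open>
  If \<open>f\<close> and \<open>g\<close> both belong to the duality mapping at \<open>v\<close>, then evaluating \<open>f\<close> at \<open>v + t w\<close> and \<open>g\<close>
  at \<open>v - t w\<close> bounds \<open>t * (f w - g w)\<close> by a multiple of the second difference of the norm, which is
  \<open>o(t)\<close>; the roles of \<open>f\<close> and \<open>g\<close> can be exchanged.
\<close>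

lemma duality_mapping_unique:
  assumes V: "subspace V" and sm: "uniformly_smooth_on V" and v: "v \<in> V"
    and f: "f \<in> duality_mapping s V v" and g: "g \<in> duality_mapping s V v"
  shows "f = g"
proof (cases "v = 0")
  case True
  have "h w = 0" if "h \<in> duality_mapping s V v" for h w
  proof (cases "w \<in> V")
    case True
    then show ?thesis
      using dual_norm_bound[OF V _ True, of h] that \<open>v = 0\<close> by (simp add: duality_mapping_def)
  qed (use that in \<open>auto simp: duality_mapping_def dual_space_def\<close>)
  from this[OF f] this[OF g] show ?thesis by auto
next
  case False
  have le: "f w - g w \<le> 0" if f: "f \<in> duality_mapping s V v" and g: "g \<in> duality_mapping s V v"
    and w: "w \<in> V" for f g w
  proof (rule tendsto_lowerbound)
    let ?q = "\<lambda>t. (norm (v + t *\<^sub>R w) + norm (v - t *\<^sub>R w) - 2 * norm v) / t"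
    show "((\<lambda>t. norm v powr (s - 1) * ?q t) \<longlongrightarrow> 0) (at_right 0)"
      using uniformly_smooth_second_difference[OF V sm v w False] tendsto_mult_right_zero by blast
    have "f w - g w \<le> norm v powr (s - 1) * ?q t" if t: "t > 0" for t
    proof -
      have F: "f \<in> dual_space V" "dual_norm V f = norm v powr (s - 1)" "f v = norm v powr s"
        and G: "g \<in> dual_space V" "dual_norm V g = norm v powr (s - 1)" "g v = norm v powr s"
        using f g by (auto simp: duality_mapping_def)
      have mem: "v + t *\<^sub>R w \<in> V" "v - t *\<^sub>R w \<in> V" "t *\<^sub>R w \<in> V" "(- t) *\<^sub>R w \<in> V"
        by (rule subspace_add[OF V v subspace_scale[OF V w]] subspace_diff[OF V v subspace_scale[OF V w]]
            subspace_scale[OF V w])+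
      have lin: "h (v + c *\<^sub>R w) = h v + c * h w" if h: "h \<in> dual_space V" for h c
      proof -
        have "h (v + c *\<^sub>R w) = h v + h (c *\<^sub>R w)" "h (c *\<^sub>R w) = c * h w"
          using h v w subspace_scale[OF V w, of c] by (simp_all add: dual_space_def)
        then show ?thesis by simp
      qed
      have "f (v + t *\<^sub>R w) = f v + t * f w" "g (v - t *\<^sub>R w) = g v - t * g w"
        using lin[OF F(1), of t] lin[OF G(1), of "- t"] by simp_all
      moreover have "f (v + t *\<^sub>R w) \<le> norm v powr (s - 1) * norm (v + t *\<^sub>R w)"
        using dual_norm_bound[OF V F(1) mem(1)] F(2) by simp
      moreover have "g (v - t *\<^sub>R w) \<le> norm v powr (s - 1) * norm (v - t *\<^sub>R w)"
        using dual_norm_bound[OF V G(1) mem(2)] G(2) by simp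
      moreover have "norm v powr s = norm v powr (s - 1) * norm v"
        using False by (simp add: powr_diff)
      ultimately have "t * (f w - g w)
          \<le> norm v powr (s - 1) * (norm (v + t *\<^sub>R w) + norm (v - t *\<^sub>R w) - 2 * norm v)"
        using F(3) G(3) by (simp add: algebra_simps)
      then show ?thesis using t by (simp add: field_simps)
    qed
    then show "\<forall>\<^sub>F t in at_right 0. f w - g w \<le> norm v powr (s - 1) * ?q t"
      by (auto intro!: eventually_mono[OF eventually_at_right_less])
  qed auto
  show ?thesis
  proof
    fix w
    show "f w = g w"
    proof (cases "w \<in> V")
      case True
      then show ?thesis using le[OF f g True] le[OF g f True] by simp
    qed (use f g in \<open>auto simp: duality_mapping_def dual_space_def\<close>)
  qed
qed

text \<open>
  The function \<open>duality_map\<close> is a definite description, so existence and uniqueness must both be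
  known before anything can be said about its values. Existence follows by scaling the norming
  functional by \<open>norm v powr (s - 1)\<close>.
\<close>

lemma duality_map_in_duality_mapping:
  assumes V: "subspace V" and sm: "uniformly_smooth_on V" and v: "v \<in> V" and s: "s > 1"
  shows "duality_map s V v \<in> duality_mapping s V v"
proof -
  have "\<exists>f. f \<in> duality_mapping s V v"
  proof (cases "v = 0")
    case True
    have "{w \<in> V. norm w \<le> 1} \<noteq> {}" using V by (auto simp: subspace_0 intro!: exI[of _ 0])
    then have "(\<lambda>w. 0) \<in> duality_mapping s V v"
      using s True by (auto simp: duality_mapping_def dual_space_def dual_norm_def intro!: exI[of _ 0])
    then show ?thesis by blast
  next
    case False
    obtain f where f: "f \<in> dual_space V" "f v = norm v" "\<And>w. w \<in> V \<Longrightarrow> \<bar>f w\<bar> \<le> norm w"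
      using uniformly_smooth_norming_functional[OF V sm v False] by blast
    define c where "c = norm v powr (s - 1)"
    have c: "c > 0" using False by (simp add: c_def)
    define h where "h = (\<lambda>w. c * f w)"
    have mem: "h \<in> dual_space V"
      using f c unfolding dual_space_def h_def
      by (auto simp: algebra_simps abs_mult intro!: exI[of _ c])
    have "\<bar>h w\<bar> \<le> c" if "w \<in> V" "norm w \<le> 1" for w
    proof -
      have "\<bar>f w\<bar> \<le> 1" using f(3)[OF that(1)] that(2) by simp
      then show ?thesis using c by (simp add: h_def abs_mult)
    qed
    then have "dual_norm V h \<le> c"
      unfolding dual_norm_def using V by (intro cSUP_least) (auto simp: subspace_0 intro!: exI[of _ 0])
    moreover have "c * norm v \<le> dual_norm V h * norm v"
      using dual_norm_bound[OF V mem v] f(2) c by (simp add: h_def)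
    then have "c \<le> dual_norm V h" using False by simp
    moreover have "h v = norm v powr s"
      using False f(2) by (simp add: h_def c_def powr_diff)
    ultimately have "h \<in> duality_mapping s V v"
      using mem by (simp add: duality_mapping_def c_def)
    then show ?thesis by blast
  qed
  then have "\<exists>!f. f \<in> duality_mapping s V v"
    using duality_mapping_unique[OF V sm v] by blast
  then show ?thesis unfolding duality_map_def by (rule theI')
qed

lemma adjoint_apply_dual:
  assumes V: "subspace V" and f: "f \<in> dual_space V" and L: "\<And>h. blinfun_apply L h \<in> V"
  shows "blinfun_apply (adjoint_apply L f) h = f (blinfun_apply L h)"
    and "norm (adjoint_apply L f) \<le> dual_norm V f * norm L"
proof -
  have nn: "0 \<le> dual_norm V f"
  proof (cases "\<exists>v\<in>V. v \<noteq> 0")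
    case True
    then obtain v where v: "v \<in> V" "v \<noteq> 0" by blast
    then have "0 \<le> dual_norm V f * norm v" using dual_norm_bound[OF V f v(1)] by linarith
    then show ?thesis using v by (simp add: zero_le_mult_iff)
  next
    case False
    then have "{v \<in> V. norm v \<le> 1} = {0}" using V by (auto simp: subspace_0)
    then show ?thesis by (simp add: dual_norm_def)
  qed
  have bd: "norm (f (blinfun_apply L h)) \<le> norm h * (dual_norm V f * norm L)" for h
  proof -
    have "norm (f (blinfun_apply L h)) \<le> dual_norm V f * norm (blinfun_apply L h)"
      using dual_norm_bound[OF V f L] by simp
    also have "\<dots> \<le> dual_norm V f * (norm L * norm h)"
      using nn norm_blinfun by (intro mult_left_mono) auto
    finally show ?thesis by (simp add: ac_simps)
  qed
  have "bounded_linear (\<lambda>h. f (blinfun_apply L h))"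
    using f L bd by (intro bounded_linear_intro[of _ "dual_norm V f * norm L"])
      (auto simp: dual_space_def blinfun.add_right blinfun.scaleR_right)
  then show *: "blinfun_apply (adjoint_apply L f) h = f (blinfun_apply L h)" for h
    unfolding adjoint_apply_def by (simp add: bounded_linear_Blinfun_apply)
  show "norm (adjoint_apply L f) \<le> dual_norm V f * norm L"
    using nn bd by (intro norm_blinfun_bound) (auto simp: * mult.commute)
qed

text \<open>
  Applied to the linearised residual \<open>k = L (x - z)\<close> at a solution \<open>z\<close>: it deviates from the residual
  \<open>r\<close> by at most \<open>\<gamma> * norm r\<close>, from the cone condition, plus a noise term, and \<open>f\<close>, which is aligned
  with \<open>r\<close>, cannot see more than this deviation.
\<close>

lemma duality_mapping_pairing:
  assumes V: "subspace V" and f: "f \<in> duality_mapping s V r" and r: "r \<in> V" and k: "k \<in> V"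
    and rk: "norm (r - k) \<le> \<gamma> * norm r + c"
  shows "(1 - \<gamma>) * norm r powr s - c * norm r powr (s - 1) \<le> f k"
proof -
  have fd: "f \<in> dual_space V" and fn: "dual_norm V f = norm r powr (s - 1)" and fr: "f r = norm r powr s"
    using f by (auto simp: duality_mapping_def)
  have d: "r - k \<in> V" by (rule subspace_diff[OF V r k])
  have "f (k + (r - k)) = f k + f (r - k)" using fd k d unfolding dual_space_def by blast
  then have "f k = norm r powr s - f (r - k)" by (simp add: fr)
  moreover have "f (r - k) \<le> norm r powr (s - 1) * norm (r - k)"
    using dual_norm_bound[OF V fd d] by (simp add: fn)
  moreover have "norm r powr (s - 1) * norm (r - k) \<le> norm r powr (s - 1) * (\<gamma> * norm r + c)"
    using rk by (intro mult_left_mono) auto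
  moreover have "norm r powr (s - 1) * norm r = norm r powr s"
    by (cases "r = 0") (simp_all add: powr_diff)
  then have "norm r powr (s - 1) * (\<gamma> * norm r + c) = \<gamma> * norm r powr s + c * norm r powr (s - 1)"
    by (metis distrib_left mult.commute mult.left_commute)
  ultimately show ?thesis by (simp add: left_diff_distrib)
qed

section \<open>Subgradients of a convex function and Bregman distances\<close>

text \<open>
  Compare the subgradient inequality and \<open>p\<close>-convexity at the midpoint of \<open>x\<close> and \<open>z\<close>. In terms of the
  \<open>e\<close>-Bregman distance the bound reads \<open>c / 2 * norm (z - x) powr p \<le> eps_bregman e \<xi> \<Theta> z x + e\<close>; the
  extra \<open>e\<close> appears because at the midpoint the error \<open>e\<close> is not halved.
\<close>

lemma eps_subgradient_lower_bound:
  assumes conv: "p_convex p c \<Theta>" and \<xi>: "\<xi> \<in> eps_subdifferential e \<Theta> x"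
    and x: "\<Theta> x = ereal a" and z: "\<Theta> z = ereal b"
  shows "c / 2 * norm (z - x) powr p \<le> b - a - blinfun_apply \<xi> (z - x) + 2 * e"
proof -
  define m where "m = (1 / 2) *\<^sub>R z + (1 - 1 / 2) *\<^sub>R x"
  have "m - x = (1 / 2) *\<^sub>R (z - x)" by (simp add: m_def algebra_simps)
      (metis add_diff_cancel_right' diff_add_eq field_sum_of_halves scaleR_half_double scaleR_one scaleR_left_distrib)
  then have half: "blinfun_apply \<xi> (m - x) = blinfun_apply \<xi> (z - x) / 2"
    by (simp add: blinfun.scaleR_right)
  have "\<Theta> x + ereal (blinfun_apply \<xi> (m - x)) - ereal e \<le> \<Theta> m"
    using \<xi> by (simp add: eps_subdifferential_def)
  then have "ereal (a + blinfun_apply \<xi> (z - x) / 2 - e) + ereal (c * (1 / 2) * (1 - 1 / 2) * norm (z - x) powr p)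
      \<le> \<Theta> m + ereal (c * (1 / 2) * (1 - 1 / 2) * norm (z - x) powr p)"
    using x unfolding half by (intro add_right_mono) simp
  also have "\<dots> \<le> ereal (1 / 2) * \<Theta> z + ereal (1 - 1 / 2) * \<Theta> x"
    using conv[unfolded p_convex_def, rule_format, of "1 / 2" z x] unfolding m_def by simp
  also have "\<dots> = ereal (b / 2 + a / 2)" using x z by simp
  finally show ?thesis by (simp add: field_simps)
qed

lemma eps_minimizer_subgradient:
  assumes proper: "proper_fun \<Theta>"
    and min: "\<Theta> u - ereal (blinfun_apply \<eta> u) \<le> (INF z. \<Theta> z - ereal (blinfun_apply \<eta> z)) + ereal e"
  shows "u \<in> effective_domain \<Theta>" and "\<eta> \<in> eps_subdifferential e \<Theta> u"
proof -
  have le: "\<Theta> u - ereal (blinfun_apply \<eta> u) \<le> \<Theta> z - ereal (blinfun_apply \<eta> z) + ereal e" for z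
    using min by (rule order_trans) (intro add_right_mono INF_lower, simp)
  have fin: "\<Theta> z \<noteq> -\<infinity>" for z using proper by (simp add: proper_fun_def)
  obtain w where "\<Theta> w < \<infinity>" using proper by (auto simp: proper_fun_def effective_domain_def)
  then obtain c where "\<Theta> w = ereal c" using fin[of w] by (cases "\<Theta> w") auto
  with le[of w] have "\<Theta> u < \<infinity>" by (cases "\<Theta> u") auto
  then show "u \<in> effective_domain \<Theta>" by (simp add: effective_domain_def)
  from \<open>\<Theta> u < \<infinity>\<close> fin[of u] obtain a where a: "\<Theta> u = ereal a" by (cases "\<Theta> u") auto
  have "\<Theta> u + ereal (blinfun_apply \<eta> (z - u)) - ereal e \<le> \<Theta> z" for z
    using le[of z] a fin[of z] by (cases "\<Theta> z") (auto simp: blinfun.diff_right)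
  then show "\<eta> \<in> eps_subdifferential e \<Theta> u" by (simp add: eps_subdifferential_def)
qed

text \<open>
  The change of the Bregman distance to \<open>z\<close> is minus the Bregman distance between the two iterates,
  plus the pairing of the update with \<open>z - x'\<close>. Writing \<open>z - x' = (z - x) + (x - x')\<close> separates
  the term that the residual controls from the coupling with the movement of the iterate, which
  the convexity gain \<open>- c / 2 * norm (x' - x) powr p\<close> has to absorb.
\<close>

lemma eps_bregman_step:
  assumes conv: "p_convex p c \<Theta>" and \<xi>: "\<xi> \<in> eps_subdifferential e \<Theta> x"
    and x: "\<Theta> x = ereal a" and x': "\<Theta> x' = ereal a'" and \<mu>: "\<mu> \<ge> 0"
  shows "(b - a' - blinfun_apply (\<xi> - \<mu> *\<^sub>R g) (z - x') + e') - (b - a - blinfun_apply \<xi> (z - x) + e)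
      \<le> e + e' - \<mu> * blinfun_apply g (x - z) + \<mu> * norm g * norm (x' - x) - c / 2 * norm (x' - x) powr p"
proof -
  have "blinfun_apply g (x - x') \<le> norm g * norm (x' - x)"
    using norm_blinfun[of g "x - x'"] by (simp add: norm_minus_commute abs_le_iff)
  then have "\<mu> * blinfun_apply g (x - x') \<le> \<mu> * (norm g * norm (x' - x))"
    using \<mu> by (intro mult_left_mono) auto
  moreover have "c / 2 * norm (x' - x) powr p \<le> a' - a - blinfun_apply \<xi> (x' - x) + 2 * e"
    by (rule eps_subgradient_lower_bound[OF conv \<xi> x x'])
  ultimately show ?thesis
    by (simp add: blinfun.diff_left blinfun.diff_right blinfun.scaleR_left algebra_simps)
qed

lemma eps_bregman_ereal:
  assumes "\<Theta> x = ereal a" "\<Theta> z = ereal b"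
  shows "eps_bregman e \<xi> \<Theta> z x = ereal (b - a - blinfun_apply \<xi> (z - x) + e)"
  using assms by (simp add: eps_bregman_def)

section \<open>Boundedness from the tangential cone condition\<close>

text \<open>
  A continuous family of operators may be unbounded on a ball of an infinite-dimensional space, yet
  the cone condition bounds it. At the centre it shows that \<open>F\<close> is bounded on the ball; at \<open>z\<close> it then
  bounds \<open>L z (w - z)\<close> for all \<open>w\<close> in the ball. For \<open>norm h \<le> R\<close> the vector \<open>L z h\<close> is
  the difference of two such vectors, for \<open>w = x\<^sub>0 + h\<close> and \<open>w = x\<^sub>0\<close>, so that the bound holds up to the boundary of the ball.
\<close>

lemma tangential_cone_bounded_derivative:
  fixes F :: "'a::real_normed_vector \<Rightarrow> 'b::real_normed_vector" and L :: "'a \<Rightarrow> 'a \<Rightarrow>\<^sub>L 'b"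
  assumes R: "R > 0" and \<gamma>: "0 \<le> \<gamma>" "\<gamma> < 1"
    and cone: "\<And>w z. w \<in> cball x\<^sub>0 R \<Longrightarrow> z \<in> cball x\<^sub>0 R \<Longrightarrow>
      norm (F w - F z - blinfun_apply (L z) (w - z)) \<le> \<gamma> * norm (F w - F z)"
    and z: "z \<in> cball x\<^sub>0 R"
  shows "norm (L z) \<le> 3 * (1 + \<gamma>) / (1 - \<gamma>) * norm (L x\<^sub>0)"
proof -
  have x0: "x\<^sub>0 \<in> cball x\<^sub>0 R" using R by simp
  define M where "M = R * norm (L x\<^sub>0) / (1 - \<gamma>)"
  have M: "norm (F w - F x\<^sub>0) \<le> M" if w: "w \<in> cball x\<^sub>0 R" for w
  proof -
    have "norm (F w - F x\<^sub>0) \<le> norm (blinfun_apply (L x\<^sub>0) (w - x\<^sub>0)) + \<gamma> * norm (F w - F x\<^sub>0)"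
      using cone[OF w x0] norm_triangle_sub[of "F w - F x\<^sub>0" "blinfun_apply (L x\<^sub>0) (w - x\<^sub>0)"] by simp
    also have "norm (blinfun_apply (L x\<^sub>0) (w - x\<^sub>0)) \<le> norm (L x\<^sub>0) * norm (w - x\<^sub>0)"
      by (rule norm_blinfun)
    also have "\<dots> \<le> norm (L x\<^sub>0) * R"
      using w by (intro mult_left_mono) (auto simp: dist_norm norm_minus_commute)
    finally show ?thesis using \<gamma> by (simp add: M_def field_simps)
  qed
  have Lw: "norm (blinfun_apply (L z) (w - z)) \<le> (1 + \<gamma>) * norm (F w - F z)" if w: "w \<in> cball x\<^sub>0 R" for w
  proof -
    have "norm (blinfun_apply (L z) (w - z)) \<le> norm (F w - F z) + norm (F w - F z - blinfun_apply (L z) (w - z))"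
      using norm_triangle_sub[of "blinfun_apply (L z) (w - z)" "F w - F z"] by (simp add: norm_minus_commute)
    with cone[OF w z] show ?thesis by (simp add: algebra_simps)
  qed
  have Lh: "norm (blinfun_apply (L z) h) \<le> 3 * (1 + \<gamma>) * M" if h: "norm h \<le> R" for h
  proof -
    have w: "x\<^sub>0 + h \<in> cball x\<^sub>0 R" using h by (simp add: dist_norm)
    have "blinfun_apply (L z) h = blinfun_apply (L z) (x\<^sub>0 + h - z) - blinfun_apply (L z) (x\<^sub>0 - z)"
      by (simp flip: blinfun.diff_right)
    then have "norm (blinfun_apply (L z) h)
        \<le> norm (blinfun_apply (L z) (x\<^sub>0 + h - z)) + norm (blinfun_apply (L z) (x\<^sub>0 - z))"
      by (simp add: norm_triangle_ineq4)
    also have "\<dots> \<le> (1 + \<gamma>) * norm (F (x\<^sub>0 + h) - F z) + (1 + \<gamma>) * norm (F x\<^sub>0 - F z)"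
      by (intro add_mono Lw w x0)
    also have "\<dots> = (1 + \<gamma>) * (norm (F (x\<^sub>0 + h) - F z) + norm (F x\<^sub>0 - F z))"
      by (simp add: algebra_simps)
    also have "\<dots> \<le> (1 + \<gamma>) * (3 * M)"
    proof (rule mult_left_mono)
      have "norm (F (x\<^sub>0 + h) - F z) \<le> norm (F (x\<^sub>0 + h) - F x\<^sub>0) + norm (F z - F x\<^sub>0)"
        using norm_triangle_ineq4[of "F (x\<^sub>0 + h) - F x\<^sub>0" "F z - F x\<^sub>0"] by simp
      then show "norm (F (x\<^sub>0 + h) - F z) + norm (F x\<^sub>0 - F z) \<le> 3 * M"
        using M[OF w] M[OF z] by (simp add: norm_minus_commute)
    qed (use \<gamma> in simp)
    finally show ?thesis by argo
  qed
  show ?thesis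
  proof (rule norm_blinfun_bound)
    fix h
    show "norm (blinfun_apply (L z) h) \<le> 3 * (1 + \<gamma>) / (1 - \<gamma>) * norm (L x\<^sub>0) * norm h"
    proof (cases "h = 0")
      case False
      have "norm (blinfun_apply (L z) ((R / norm h) *\<^sub>R h)) \<le> 3 * (1 + \<gamma>) * M"
        using R False by (intro Lh) simp
      then have "R / norm h * norm (blinfun_apply (L z) h) \<le> 3 * (1 + \<gamma>) * M"
        using R by (simp add: blinfun.scaleR_right)
      then have "norm (blinfun_apply (L z) h) \<le> 3 * (1 + \<gamma>) * M * norm h / R"
        using R False by (simp add: field_simps)
      then show ?thesis using R by (simp add: M_def)
    qed simp
  qed (use \<gamma> in simp)
qed

text \<open>
  \<open>Blinfun\<close> returns the functional it is given only if that is bounded and linear; here both follow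
  from the fact that \<open>L\<close> takes its values in \<open>V\<close>, where \<open>f\<close> is linear and controlled by its dual norm.
\<close>

section \<open>Scalar inequalities for a single step\<close>

text \<open>
  The update of the dual iterate by \<open>\<mu> * G\<close> (here \<open>\<mu> = m * R powr (1 - s / p)\<close>) moves the primal
  iterate by \<open>d\<close>. The coupling of the two movements is paid for partly by the convexity gain
  \<open>c\<^sub>0 / 2 * d powr p\<close> and partly by a multiple of \<open>m * R\<close>. The exponent \<open>1 - s / p\<close> is exactly the
  one for which the cap on \<open>m\<close> in \<open>mG\<close> gives \<open>\<mu> * G \<le> b powr (1 / p) * (m * R) powr (1 / pstar)\<close>;
  Young's inequality does the rest.
\<close>

lemma step_coupling_bound:
  fixes p pstar s c\<^sub>0 b m a R G d :: real
  assumes p: "p \<ge> 2" and pstar: "1 / p + 1 / pstar = 1" and c: "c\<^sub>0 > 0" and b: "b > 0"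
    and s: "s > 1" and m: "m \<ge> 0" and a: "a \<ge> 0" and R: "R > 0" "a powr p \<le> R" and G: "G \<ge> 0" and d: "d \<ge> 0"
    and mG: "m * G powr p \<le> b * a powr (p * (s - 1))"
  shows "m * R powr (1 - s / p) * G * d - c\<^sub>0 / 2 * d powr p
           \<le> 2 / pstar * (b / (2 * c\<^sub>0)) powr (pstar - 1) * (m * R)"
proof (cases "m = 0 \<or> G = 0 \<or> d = 0")
  case True
  have "0 < 1 / pstar" using p pstar by (smt (verit) divide_less_eq_1)
  then have "pstar > 0" by simp
  moreover have "m * R powr (1 - s / p) * G * d = 0" using True by auto
  ultimately show ?thesis using c b m R
    by (smt (verit) divide_nonneg_nonneg mult_nonneg_nonneg powr_ge_zero)
next
  case False
  then have pos: "m > 0" "G > 0" "d > 0" using m G d by auto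
  have qi: "1 / pstar = 1 - 1 / p" using pstar by simp
  have "1 / pstar > 0" "1 / pstar < 1" using qi p by auto
  then have q: "pstar > 1" by simp
  have qeq: "pstar = p / (p - 1)" using pstar p q by (simp add: field_simps)
  have q2: "pstar - 1 = 1 / (p - 1)" using p by (simp add: qeq field_simps)
  have q3: "pstar - 1 \<le> 1" using p by (simp add: q2)
  have "(m * G powr p) powr (1 / p) \<le> (b * a powr (p * (s - 1))) powr (1 / p)"
    using mG m p by (intro powr_mono2) auto
  then have "m powr (1 / p) * G \<le> b powr (1 / p) * a powr (s - 1)"
    using pos b a p by (simp add: powr_mult powr_powr)
  also have "a powr (s - 1) = (a powr p) powr ((s - 1) / p)"
    using p by (simp add: powr_powr)
  also have "\<dots> \<le> R powr ((s - 1) / p)"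
    using R s p by (intro powr_mono2) auto
  finally have 1: "m powr (1 / p) * G \<le> b powr (1 / p) * R powr ((s - 1) / p)"
    using b by simp
  have "m * R powr (1 - s / p) * G = m powr (1 / pstar) * R powr (1 - s / p) * (m powr (1 / p) * G)"
    using pos by (simp add: qi powr_diff)
  also have "\<dots> \<le> m powr (1 / pstar) * R powr (1 - s / p) * (b powr (1 / p) * R powr ((s - 1) / p))"
    using 1 by (intro mult_left_mono) auto
  also have "\<dots> = b powr (1 / p) * m powr (1 / pstar) * (R powr (1 - s / p) * R powr ((s - 1) / p))"
    by simp
  also have "R powr (1 - s / p) * R powr ((s - 1) / p) = R powr (1 / pstar)"
    by (simp add: qi diff_divide_distrib flip: powr_add)
  finally have 2: "m * R powr (1 - s / p) * G \<le> b powr (1 / p) * (m * R) powr (1 / pstar)"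
    using pos R by (simp add: powr_mult mult.assoc)
  \<comment> \<open>The weight \<open>l\<close> in Young's inequality is the one that turns the \<open>d\<close>-term into exactly
    \<open>c\<^sub>0 / 2 * d powr p\<close>.\<close>
  define l where "l = p * c\<^sub>0 / (2 * b)"
  have l: "l > 0" using p c b by (simp add: l_def)
  have "(l * b * d powr p) powr (1 / p) * (l powr (1 - pstar) * (m * R)) powr (1 / pstar)
      \<le> 1 / p * (l * b * d powr p) + 1 / pstar * (l powr (1 - pstar) * (m * R))"
    using l b pos R p q pstar by (intro Youngs_inequality_0) auto
  also have "1 / p * (l * b * d powr p) = c\<^sub>0 / 2 * d powr p"
    using p b by (simp add: l_def)
  also have "(l * b * d powr p) powr (1 / p) = l powr (1 / p) * b powr (1 / p) * d"
    using l b pos p by (simp add: powr_mult powr_powr)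
  also have "(l powr (1 - pstar) * (m * R)) powr (1 / pstar)
      = l powr ((1 - pstar) / pstar) * (m * R) powr (1 / pstar)"
    using l pos R by (simp add: powr_mult powr_powr)
  also have "(1 - pstar) / pstar = - (1 / p)"
    using q qi by (simp add: diff_divide_distrib)
  finally have 3: "b powr (1 / p) * (m * R) powr (1 / pstar) * d
      \<le> c\<^sub>0 / 2 * d powr p + 1 / pstar * (l powr (1 - pstar) * (m * R))"
    using l by (simp add: powr_minus field_simps)
  \<comment> \<open>The resulting constant is \<open>(2 * b / (p * c\<^sub>0)) powr (pstar - 1)\<close>; \<open>p \<ge> 2\<close>, and hence
    \<open>pstar \<le> 2\<close>, allows the factor \<open>(4 / p) powr (pstar - 1)\<close> to be replaced by \<open>2\<close>.\<close>
  have "l powr (1 - pstar) = (1 / l) powr (pstar - 1)"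
    using l by (simp add: powr_divide powr_diff)
  also have "1 / l = 4 / p * (b / (2 * c\<^sub>0))"
    using p c b by (simp add: l_def)
  also have "(4 / p * (b / (2 * c\<^sub>0))) powr (pstar - 1) = (4 / p) powr (pstar - 1) * (b / (2 * c\<^sub>0)) powr (pstar - 1)"
    by (rule powr_mult)
  also have "(4 / p) powr (pstar - 1) \<le> 2 powr (pstar - 1)"
    using p q by (intro powr_mono2) (auto simp: divide_le_eq)
  also have "2 powr (pstar - 1) \<le> (2 :: real)"
    using q3 powr_mono[of "pstar - 1" 1 2] by simp
  finally have 4: "l powr (1 - pstar) \<le> 2 * (b / (2 * c\<^sub>0)) powr (pstar - 1)"
    by (simp add: mult_right_mono)
  have "1 / pstar * (l powr (1 - pstar) * (m * R))
      \<le> 1 / pstar * (2 * (b / (2 * c\<^sub>0)) powr (pstar - 1) * (m * R))"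
    using 4 q pos R by (intro mult_left_mono mult_right_mono) auto
  moreover have "m * R powr (1 - s / p) * G * d \<le> b powr (1 / p) * (m * R) powr (1 / pstar) * d"
    using 2 d by (intro mult_right_mono) auto
  ultimately show ?thesis using 3 by simp
qed

text \<open>
  Convexity of \<open>x \<mapsto> x powr t\<close> applied to \<open>a + e\<close> as a weighted mean of \<open>a / u\<close> and \<open>e / (1 - u)\<close>. The
  weight \<open>u = b powr (- 1 / (t - 1))\<close> is chosen so that \<open>a powr t\<close> gets the factor \<open>b\<close>; the factor of
  \<open>e powr t\<close> then is forced.
\<close>

lemma powr_sum_split:
  fixes b t a e :: real
  assumes b: "b > 1" and t: "t > 1" and a: "a \<ge> 0" and e: "e \<ge> 0"
  shows "(a + e) powr t \<le> b * (a powr t + (b powr (1 / (t - 1)) - 1) powr (1 - t) * e powr t)"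
proof -
  define B where "B = b powr (1 / (t - 1))"
  have B: "B > 1" using b t by (simp add: B_def)
  have Bt: "B powr (t - 1) = b" using b t by (simp add: B_def powr_powr)
  define l where "l = B - 1"
  have l: "l > 0" using B by (simp add: l_def)
  have kl: "(b powr (1 / (t - 1)) - 1) powr (1 - t) = l powr (1 - t)"
    by (simp add: l_def B_def)
  consider "a = 0" | "e = 0" | "a > 0" "e > 0" using a e by linarith
  then show ?thesis
  proof cases
    case 1
    have "b * l powr (1 - t) = (B / l) powr (t - 1)"
      using l B powr_minus_divide[of l "t - 1"] by (simp add: powr_divide Bt)
    moreover have "(B / l) powr (t - 1) \<ge> 1"
      using l B t by (intro ge_one_powr_ge_zero) (auto simp: l_def)
    ultimately have "1 * e powr t \<le> b * l powr (1 - t) * e powr t"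
      by (intro mult_right_mono) auto
    then show ?thesis using 1 t by (simp add: kl)
  next
    case 2
    have "1 * a powr t \<le> b * a powr t" using b by (intro mult_right_mono) auto
    then show ?thesis using 2 t by simp
  next
    case 3
    have w: "1 - l / B = 1 / B" using B by (simp add: l_def field_simps)
    have "((1 - l / B) *\<^sub>R (B * a) + (l / B) *\<^sub>R (B / l * e)) powr t
        \<le> (1 - l / B) * (B * a) powr t + (l / B) * (B / l * e) powr t"
      using t B l 3 by (intro convex_onD[OF powr_convex]) (auto simp: l_def)
    then have "((1 / B) * (B * a) + (l / B) * (B / l * e)) powr t
        \<le> (1 / B) * (B * a) powr t + (l / B) * (B / l * e) powr t"
      by (simp only: w real_scaleR_def)
    also have "(1 / B) * (B * a) + (l / B) * (B / l * e) = a + e" using B l by simp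
    also have "(1 / B) * (B * a) powr t = B powr (t - 1) * a powr t"
      using B 3 by (simp add: powr_mult powr_diff)
    also have "(l / B) * (B / l * e) powr t = B powr (t - 1) * (l powr (1 - t) * e powr t)"
      using B l 3 by (simp add: powr_mult powr_divide powr_diff)
    finally show ?thesis unfolding Bt kl by (simp add: algebra_simps)
  qed
qed

text \<open>
  The step size is built from \<open>a powr p + e\<close>, the pairing with the residual only yields \<open>a powr s\<close>;
  passing from one to the other costs the factor \<open>1 / b\<close> and a multiple \<open>k\<close> of \<open>e\<close>. For \<open>p \<ge> s\<close> the map
  \<open>x \<mapsto> x powr (1 - s / p)\<close> is increasing, so \<open>a powr p\<close> itself is a lower bound and \<open>k = 1\<close> will do.
  For \<open>p < s\<close> the exponent \<open>s / p\<close> exceeds \<open>1\<close> and the sum has to be split by convexity, which is where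
  the second form of \<open>k\<close> comes from.
\<close>

lemma residual_lower_bound:
  fixes p s a e b k :: real
  assumes p: "p > 0" and b: "b > 1" and a: "a \<ge> 0" and e: "e \<ge> 0" and R: "a powr p + e > 0"
    and k: "k = (if p \<ge> s then 1 else (b powr (p / (s - p)) - 1) powr ((p - s) / p))"
  shows "(a powr p + e) / b - k * e \<le> (a powr p + e) powr (1 - s / p) * a powr s"
proof -
  define A where "A = a powr p"
  have A: "A \<ge> 0" by (simp add: A_def)
  have as: "a powr s = A powr (s / p)" using p by (simp add: A_def powr_powr)
  have pow: "(A + e) = (A + e) powr (1 - s / p) * (A + e) powr (s / p)"
    using R by (simp add: A_def flip: powr_add)
  show ?thesis
  proof (cases "p \<ge> s")
    case True
    have "(A + e) / b - e \<le> A"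
      using b A e divide_left_mono[of 1 b "A + e"] by simp
    also have "A = A powr (1 - s / p) * A powr (s / p)"
      using A by (cases "A = 0") (simp_all flip: powr_add)
    also have "\<dots> \<le> (A + e) powr (1 - s / p) * A powr (s / p)"
      using True p A e by (intro mult_right_mono powr_mono2) auto
    finally show ?thesis using True by (simp add: as k flip: A_def)
  next
    case False
    have "(A + e) powr (s / p)
        \<le> b * (A powr (s / p) + (b powr (1 / (s / p - 1)) - 1) powr (1 - s / p) * e powr (s / p))"
      using False p b A e by (intro powr_sum_split) auto
    also have "1 / (s / p - 1) = p / (s - p)" using p False by (simp add: field_simps)
    also have "1 - s / p = (p - s) / p" using p by (simp add: field_simps)
    finally have "(A + e) powr (s / p) \<le> b * (A powr (s / p) + k * e powr (s / p))"
      using False by (simp add: k)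
    then have "(A + e) powr (1 - s / p) * (A + e) powr (s / p)
        \<le> (A + e) powr (1 - s / p) * (b * (A powr (s / p) + k * e powr (s / p)))"
      by (intro mult_left_mono) auto
    then have "(A + e) / b \<le> (A + e) powr (1 - s / p) * (A powr (s / p) + k * e powr (s / p))"
      using pow b by (simp add: field_simps)
    moreover have "(A + e) powr (1 - s / p) * e powr (s / p) \<le> e"
    proof (cases "e = 0")
      case False
      then have "(A + e) powr (1 - s / p) \<le> e powr (1 - s / p)"
        using \<open>\<not> p \<ge> s\<close> p A e by (intro powr_mono2') auto
      then have "(A + e) powr (1 - s / p) * e powr (s / p) \<le> e powr (1 - s / p) * e powr (s / p)"
        by (intro mult_right_mono) auto
      then show ?thesis using e False by (simp flip: powr_add)
    qed simp
    then have "k * ((A + e) powr (1 - s / p) * e powr (s / p)) \<le> k * e"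
      using k by (intro mult_left_mono) auto
    ultimately show ?thesis by (simp add: as algebra_simps flip: A_def)
  qed
qed

text \<open>
  The scalar core of the descent estimate for a step that is not skipped. Each term of the constant
  \<open>C\<close> has one source: \<open>1 / \<beta>\<close> comes from replacing
  \<open>R powr (1 - s / p) * a powr s\<close> by \<open>R\<close>, \<open>\<gamma>\<close> from the nonlinearity,
  \<open>(1 + \<gamma>) / \<tau>\<close> from the noise, which \<open>R > (\<tau> * \<delta>) powr p\<close> makes small relative to \<open>R\<close>, and the
  last term from the coupling of the dual and the primal movement. The condition on \<open>\<sigma>\<close> limits the
  cost of the perturbation \<open>\<sigma> * e\<close> in \<open>R\<close> to \<open>e\<close>.
\<close>

lemma landweber_step_decrease:
  fixes p pstar s c\<^sub>0 \<beta>\<^sub>0 \<beta>\<^sub>1 \<beta> \<gamma> \<tau> \<delta> \<sigma> \<kappa> e m a R G d :: real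
  assumes p: "p \<ge> 2" and pstar: "1 / p + 1 / pstar = 1" and c: "c\<^sub>0 > 0" and b0: "\<beta>\<^sub>0 > 0"
    and s: "s > 1" and b: "\<beta> > 1" and \<gamma>: "0 \<le> \<gamma>" "\<gamma> < 1" and t: "\<tau> > 0" and \<delta>: "\<delta> > 0" and \<sigma>: "\<sigma> > 0"
    and k: "\<kappa> = (if p \<ge> s then 1 else (\<beta> powr (p / (s - p)) - 1) powr ((p - s) / p))"
    and ks: "\<kappa> * \<beta>\<^sub>1 * \<sigma> \<le> 1"
    and m: "0 \<le> m" "m \<le> \<beta>\<^sub>1" and a: "a \<ge> 0" and e: "e \<ge> 0" and G: "G \<ge> 0" and d: "d \<ge> 0"
    and Rdef: "R = a powr p + \<sigma> * e" and R: "R > (\<tau> * \<delta>) powr p"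
    and mG: "m * G powr p \<le> \<beta>\<^sub>0 * a powr (p * (s - 1))"
  defines "\<mu> \<equiv> m * R powr (1 - s / p)"
  defines "C \<equiv> 1 / \<beta> - \<gamma> - (1 + \<gamma>) / \<tau> - 2 / pstar * (\<beta>\<^sub>0 / (2 * c\<^sub>0)) powr (pstar - 1)"
  shows "\<mu> * ((1 + \<gamma>) * \<delta> * a powr (s - 1) - (1 - \<gamma>) * a powr s) + \<mu> * G * d - c\<^sub>0 / 2 * d powr p
           \<le> e - C * (m * R)"
proof -
  have R0: "R > 0" using R powr_ge_zero[of "\<tau> * \<delta>" p] by linarith
  have ap: "a powr p \<le> R" using Rdef \<sigma> e by simp
  have A: "\<mu> * G * d - c\<^sub>0 / 2 * d powr p \<le> 2 / pstar * (\<beta>\<^sub>0 / (2 * c\<^sub>0)) powr (pstar - 1) * (m * R)"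
    unfolding \<mu>_def by (rule step_coupling_bound[OF p pstar c b0 s m(1) a R0 ap G d mG])
  have "R / \<beta> - \<kappa> * (\<sigma> * e) \<le> R powr (1 - s / p) * a powr s"
    unfolding Rdef using p b a e \<sigma> k R0 Rdef by (intro residual_lower_bound) auto
  then have "(1 - \<gamma>) * (R / \<beta> - \<kappa> * (\<sigma> * e)) \<le> (1 - \<gamma>) * (R powr (1 - s / p) * a powr s)"
    using \<gamma> by (intro mult_left_mono) auto
  moreover have "\<gamma> * R / \<beta> \<le> \<gamma> * R"
    using \<gamma> R0 b divide_left_mono[of 1 \<beta> "\<gamma> * R"] by simp
  moreover have k0: "\<kappa> \<ge> 0" using k by auto
  then have "0 \<le> \<gamma> * (\<kappa> * (\<sigma> * e))" using \<gamma> \<sigma> e by simp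
  ultimately have "(1 / \<beta> - \<gamma>) * R - \<kappa> * (\<sigma> * e) \<le> (1 - \<gamma>) * (R powr (1 - s / p) * a powr s)"
    by (simp add: algebra_simps diff_divide_distrib)
  then have "m * ((1 / \<beta> - \<gamma>) * R - \<kappa> * (\<sigma> * e)) \<le> m * ((1 - \<gamma>) * (R powr (1 - s / p) * a powr s))"
    using m by (intro mult_left_mono) auto
  moreover have "m * (\<kappa> * (\<sigma> * e)) \<le> \<beta>\<^sub>1 * (\<kappa> * (\<sigma> * e))"
    using m k0 \<sigma> e by (intro mult_right_mono) auto
  moreover have "\<kappa> * \<beta>\<^sub>1 * \<sigma> * e \<le> 1 * e" using ks e by (intro mult_right_mono) auto
  ultimately have B: "(1 / \<beta> - \<gamma>) * (m * R) - e \<le> \<mu> * ((1 - \<gamma>) * a powr s)"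
    by (simp add: \<mu>_def algebra_simps)
  have "\<tau> * \<delta> = ((\<tau> * \<delta>) powr p) powr (1 / p)" using p t \<delta> by (simp add: powr_powr)
  also have "\<dots> \<le> R powr (1 / p)" using R p by (intro powr_mono2) auto
  finally have dl: "\<delta> \<le> R powr (1 / p) / \<tau>" using t by (simp add: field_simps)
  have "a powr (s - 1) = (a powr p) powr ((s - 1) / p)" using p by (simp add: powr_powr)
  also have "\<dots> \<le> R powr ((s - 1) / p)" using ap s p by (intro powr_mono2) auto
  finally have "\<delta> * a powr (s - 1) \<le> R powr (1 / p) / \<tau> * R powr ((s - 1) / p)"
    using dl \<delta> by (intro mult_mono) auto
  then have "R powr (1 - s / p) * (\<delta> * a powr (s - 1))
      \<le> R powr (1 - s / p) * (R powr (1 / p) / \<tau> * R powr ((s - 1) / p))"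
    by (intro mult_left_mono) auto
  also have "\<dots> = R powr ((1 - s / p) + 1 / p + (s - 1) / p) / \<tau>" by (simp add: powr_add)
  also have "(1 - s / p) + 1 / p + (s - 1) / p = 1" by (simp add: diff_divide_distrib)
  finally have "R powr (1 - s / p) * (\<delta> * a powr (s - 1)) \<le> R / \<tau>" using R0 by simp
  then have "(m * (1 + \<gamma>)) * (R powr (1 - s / p) * (\<delta> * a powr (s - 1))) \<le> (m * (1 + \<gamma>)) * (R / \<tau>)"
    using m \<gamma> by (intro mult_left_mono) auto
  then have D: "\<mu> * ((1 + \<gamma>) * \<delta> * a powr (s - 1)) \<le> (1 + \<gamma>) / \<tau> * (m * R)"
    by (simp add: \<mu>_def algebra_simps add_divide_distrib)
  show ?thesis using A B D by (simp add: C_def algebra_simps)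
qed

section \<open>Descent, confinement and termination\<close>

text \<open>
  Counting in unit steps cannot jump over \<open>N\<close>, so a counter that never equals \<open>N\<close> stays below \<open>N\<close>,
  whereas it grows without bound once it is no longer reset.
\<close>

lemma consecutive_count_reaches:
  fixes q :: "nat \<Rightarrow> nat"
  assumes q: "\<And>n. q n = (if P n then (if n = 0 then 0 else q (n - 1)) + 1 else 0)"
    and N: "N \<ge> 1" and P: "\<And>n. n \<ge> m \<Longrightarrow> P n"
  shows "\<exists>n. q n = N"
proof (rule ccontr)
  assume ne: "\<not> (\<exists>n. q n = N)"
  have lt: "q n < N" for n
  proof (induction n)
    case 0
    have "q 0 \<le> 1" using q[of 0] by simp
    then show ?case using N ne by (metis le_neq_implies_less order_trans)
  next
    case (Suc n)
    have "q (Suc n) \<le> Suc (q n)" using q[of "Suc n"] by simp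
    then show ?case using Suc ne by (metis Suc_leI le_neq_implies_less order_trans)
  qed
  have "k \<le> q (m + k)" for k
  proof (induction k)
    case (Suc k)
    then show ?case using q[of "m + Suc k"] P[of "m + Suc k"] by simp
  qed simp
  then show False using lt[of "m + N"] by (metis not_less)
qed

theorem lemma3p1:
  fixes N :: nat
    and Y :: "nat \<Rightarrow> 'y::real_normed_vector set"
    and \<Theta> :: "'x::banach \<Rightarrow> ereal"
    and Dom :: "nat \<Rightarrow> 'x set"
    and F :: "nat \<Rightarrow> 'x \<Rightarrow> 'y"
    and L :: "nat \<Rightarrow> 'x \<Rightarrow> ('x \<Rightarrow>\<^sub>L 'y)"
    and y y\<delta> :: "nat \<Rightarrow> 'y"
    and S :: "real \<Rightarrow> ('x \<Rightarrow>\<^sub>L real) \<Rightarrow> 'x"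
    and p pstar s c\<^sub>0 \<rho> \<gamma> \<beta> \<beta>\<^sub>0 \<beta>\<^sub>1 \<tau> \<sigma> \<kappa> \<delta> :: real
    and x\<^sub>0 xdag :: 'x and \<xi>\<^sub>0 :: "'x \<Rightarrow>\<^sub>L real"
    and \<epsilon> :: "nat \<Rightarrow> real"
    and x :: "nat \<Rightarrow> 'x" and \<xi> :: "nat \<Rightarrow> ('x \<Rightarrow>\<^sub>L real)"
    and r :: "nat \<Rightarrow> 'y" and g :: "nat \<Rightarrow> ('x \<Rightarrow>\<^sub>L real)"
    and q :: "nat \<Rightarrow> nat" and \<mu>t \<mu> :: "nat \<Rightarrow> real"
  assumes N: "N \<ge> 1"
    and p: "p \<ge> 2" and pstar: "1 / p + 1 / pstar = 1" and s: "s > 1"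
    \<comment> \<open>the spaces\<close>
    and X_reflexive: "reflexive_on (UNIV :: 'x set)"
    and Y_banach: "\<And>i. i < N \<Longrightarrow> subspace (Y i) \<and> complete (Y i)"
    and Y_reflexive: "\<And>i. i < N \<Longrightarrow> reflexive_on (Y i)"
    and Y_smooth: "\<And>i. i < N \<Longrightarrow> uniformly_smooth_on (Y i)"
    \<comment> \<open>the system\<close>
    and F_range: "\<And>i z. i < N \<Longrightarrow> z \<in> Dom i \<Longrightarrow> F i z \<in> Y i"
    and y_in: "\<And>i. i < N \<Longrightarrow> y i \<in> Y i"
    \<comment> \<open>assumption (A1)\<close>
    and c\<^sub>0: "c\<^sub>0 > 0"
    and \<Theta>: "proper_fun \<Theta>" "lower_semicontinuous \<Theta>" "p_convex p c\<^sub>0 \<Theta>"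
    and \<rho>: "\<rho> > 0"
    and \<xi>\<^sub>0: "\<xi>\<^sub>0 \<in> subdifferential \<Theta> x\<^sub>0"
    and ball_dom: "cball x\<^sub>0 (2 * \<rho>) \<subseteq> (\<Inter>i<N. Dom i)"
    and xdag_dom: "xdag \<in> (\<Inter>i<N. Dom i)" "xdag \<in> effective_domain \<Theta>"
    and xdag_sol: "\<And>i. i < N \<Longrightarrow> F i xdag = y i"
    and xdag_close: "eps_bregman 0 \<xi>\<^sub>0 \<Theta> xdag x\<^sub>0 \<le> ereal (1 / 4 * c\<^sub>0 * \<rho> powr p)"
    and L_range: "\<And>i z h. i < N \<Longrightarrow> z \<in> cball x\<^sub>0 (2 * \<rho>) \<Longrightarrow> blinfun_apply (L i z) h \<in> Y i"
    and L_cont: "\<And>i. i < N \<Longrightarrow> continuous_on (cball x\<^sub>0 (2 * \<rho>)) (L i)"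
    and \<gamma>: "0 \<le> \<gamma>" "\<gamma> < 1"
    and cone: "\<And>i zb z. i < N \<Longrightarrow> zb \<in> cball x\<^sub>0 (2 * \<rho>) \<Longrightarrow> z \<in> cball x\<^sub>0 (2 * \<rho>) \<Longrightarrow>
        norm (F i zb - F i z - blinfun_apply (L i z) (zb - z)) \<le> \<gamma> * norm (F i zb - F i z)"
    \<comment> \<open>assumption (A2)\<close>
    and S_cont: "\<And>e. e > 0 \<Longrightarrow> continuous_on UNIV (S e)"
    and S_min: "\<And>e \<eta>. e > 0 \<Longrightarrow>
        \<Theta> (S e \<eta>) - ereal (blinfun_apply \<eta> (S e \<eta>))
          \<le> (INF z. \<Theta> z - ereal (blinfun_apply \<eta> z)) + ereal e"
    \<comment> \<open>the parameters; \<open>\<epsilon> 0 = 0\<close> is allowed\<close>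
    and \<epsilon>_0: "\<epsilon> 0 \<ge> 0" and \<epsilon>_pos: "\<And>n. n \<ge> 1 \<Longrightarrow> \<epsilon> n > 0"
    and \<epsilon>_sum: "summable \<epsilon>" "16 * (\<Sum>n. \<epsilon> n) \<le> c\<^sub>0 * \<rho> powr p"
    and \<beta>: "\<beta> > 1" "\<beta> * \<gamma> < 1"
    and \<beta>\<^sub>1: "\<beta>\<^sub>1 > 0" and \<beta>\<^sub>0: "\<beta>\<^sub>0 > 0" and \<tau>: "\<tau> > 1"
    and param: "1 / \<beta> - \<gamma> - (1 + \<gamma>) / \<tau>
                  - 2 / pstar * (\<beta>\<^sub>0 / (2 * c\<^sub>0)) powr (pstar - 1) > 0"
    and \<sigma>: "\<sigma> > 0"
    and \<kappa>: "\<kappa> = (if p \<ge> s then 1 else (\<beta> powr (p / (s - p)) - 1) powr ((p - s) / p))"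
    and \<kappa>\<sigma>: "\<kappa> * \<beta>\<^sub>1 * \<sigma> \<le> 1"
    \<comment> \<open>the noisy data\<close>
    and \<delta>: "\<delta> > 0"
    and y\<delta>: "\<And>i. i < N \<Longrightarrow> y\<delta> i \<in> Y i" "\<And>i. i < N \<Longrightarrow> norm (y\<delta> i - y i) \<le> \<delta>"
    \<comment> \<open>the method; \<open>g n\<close> is the adjoint of \<open>L\<close> applied to the duality mapping at the residual\<close>
    and r_def: "\<And>n. r n = F (n mod N) (x n) - y\<delta> (n mod N)"
    and g_def: "\<And>n. g n = adjoint_apply (L (n mod N) (x n)) (duality_map s (Y (n mod N)) (r n))"
    and q_def: "\<And>n. q n = (if norm (r n) powr p + \<sigma> * \<epsilon> n \<le> (\<tau> * \<delta>) powr p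
                            then (if n = 0 then 0 else q (n - 1)) + 1 else 0)"
    and \<mu>t_def: "\<And>n. \<mu>t n = (if norm (g n) powr p = 0 then \<beta>\<^sub>1
                              else min (\<beta>\<^sub>0 * norm (r n) powr (p * (s - 1)) / norm (g n) powr p) \<beta>\<^sub>1)"
    and \<mu>_def: "\<And>n. \<mu> n = (if norm (r n) powr p + \<sigma> * \<epsilon> n > (\<tau> * \<delta>) powr p
                            then \<mu>t n * (norm (r n) powr p + \<sigma> * \<epsilon> n) powr (1 - s / p) else 0)"
    and x_init: "x 0 = x\<^sub>0" and \<xi>_init: "\<xi> 0 = \<xi>\<^sub>0"
    and \<xi>_step: "\<And>n. \<xi> (Suc n) = \<xi> n - \<mu> n *\<^sub>R g n"
    and x_step: "\<And>n. x (Suc n) = S (\<epsilon> (Suc n)) (\<xi> (Suc n))"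
  shows "(\<forall>n. x n \<in> cball x\<^sub>0 (2 * \<rho>) \<inter> effective_domain \<Theta>)
    \<and> (\<exists>n\<^sub>\<delta>. q n\<^sub>\<delta> = N \<and> (\<forall>m<n\<^sub>\<delta>. q m \<noteq> N))
    \<and> (\<forall>xh. xh \<in> cball x\<^sub>0 (2 * \<rho>) \<inter> effective_domain \<Theta> \<and> (\<forall>i<N. F i xh = y i) \<longrightarrow>
         (\<forall>n. eps_bregman (\<epsilon> (Suc n)) (\<xi> (Suc n)) \<Theta> xh (x (Suc n))
                - eps_bregman (\<epsilon> n) (\<xi> n) \<Theta> xh (x n)
              \<le> ereal (2 * \<epsilon> n + \<epsilon> (Suc n))))"
proof -
  define \<theta> where "\<theta> z = real_of_ereal (\<Theta> z)" for z
  have fin: "\<Theta> z = ereal (\<theta> z)" if "z \<in> effective_domain \<Theta>" for z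
    using that \<Theta>(1) by (cases "\<Theta> z") (auto simp: \<theta>_def proper_fun_def effective_domain_def)
  have p0: "p > 0" using p by simp
  have \<epsilon>_nonneg: "\<epsilon> n \<ge> 0" for n
    using \<epsilon>_0 \<epsilon>_pos[of n] by (cases n) (auto simp: less_imp_le)
  define b where "b = 1 / \<beta> - \<gamma> - (1 + \<gamma>) / \<tau> - 2 / pstar * (\<beta>\<^sub>0 / (2 * c\<^sub>0)) powr (pstar - 1)"
  have b: "b > 0" using param by (simp add: b_def)
  define R where "R n = norm (r n) powr p + \<sigma> * \<epsilon> n" for n
  \<comment> \<open>\<open>w n\<close> is the guaranteed decrease of the Bregman distance in step \<open>n\<close>, up to the factor \<open>b\<close>
    and the errors \<open>\<epsilon>\<close>; a skipped step guarantees none.\<close>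
  define w where "w n = (if R n > (\<tau> * \<delta>) powr p then \<mu>t n * R n else 0)" for n
  define D where "D n z = \<theta> z - \<theta> (x n) - blinfun_apply (\<xi> n) (z - x n) + \<epsilon> n" for n z

  have x\<^sub>0_dom: "x\<^sub>0 \<in> effective_domain \<Theta>"
  proof -
    have "\<Theta> x\<^sub>0 + ereal (blinfun_apply \<xi>\<^sub>0 (xdag - x\<^sub>0)) - ereal 0 \<le> \<Theta> xdag"
      using \<xi>\<^sub>0 unfolding eps_subdifferential_def by blast
    then show ?thesis using fin[OF xdag_dom(2)] by (cases "\<Theta> x\<^sub>0") (auto simp: effective_domain_def)
  qed
  have iter: "x n \<in> effective_domain \<Theta> \<and> \<xi> n \<in> eps_subdifferential (\<epsilon> n) \<Theta> (x n)" for n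
  proof (cases n)
    case 0
    have "\<Theta> x\<^sub>0 + ereal (blinfun_apply \<xi>\<^sub>0 (z - x\<^sub>0)) - ereal (\<epsilon> 0) \<le> \<Theta> z" for z
    proof -
      have "\<Theta> x\<^sub>0 + ereal (blinfun_apply \<xi>\<^sub>0 (z - x\<^sub>0)) - ereal (\<epsilon> 0)
          \<le> \<Theta> x\<^sub>0 + ereal (blinfun_apply \<xi>\<^sub>0 (z - x\<^sub>0)) - ereal 0"
        using \<epsilon>_0 by (intro ereal_minus_mono) auto
      also have "\<dots> \<le> \<Theta> z" using \<xi>\<^sub>0 unfolding eps_subdifferential_def by blast
      finally show ?thesis .
    qed
    then show ?thesis using 0 x\<^sub>0_dom by (simp add: x_init \<xi>_init eps_subdifferential_def)
  next
    case (Suc k)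
    then show ?thesis
      using eps_minimizer_subgradient[OF \<Theta>(1) S_min[OF \<epsilon>_pos[of "Suc k"], of "\<xi> (Suc k)"]]
      by (simp add: x_step)
  qed
  have D_bregman: "eps_bregman (\<epsilon> n) (\<xi> n) \<Theta> z (x n) = ereal (D n z)"
    if "z \<in> effective_domain \<Theta>" for n z
    unfolding D_def using eps_bregman_ereal fin iter that by blast
  have D_lower: "c\<^sub>0 / 2 * norm (z - x n) powr p \<le> D n z + \<epsilon> n" if "z \<in> effective_domain \<Theta>" for n z
    using eps_subgradient_lower_bound[OF \<Theta>(3) conjunct2[OF iter] fin[OF conjunct1[OF iter]] fin[OF that], of n]
    by (simp add: D_def)

  \<comment> \<open>\<open>D 0\<close> contains the summand \<open>\<epsilon> 0\<close>, although \<open>\<xi>\<^sub>0\<close> is an exact subgradient; removing it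
    leaves the Bregman distance that the hypothesis bounds.\<close>
  have D0: "D 0 xdag - \<epsilon> 0 \<le> 1 / 4 * c\<^sub>0 * \<rho> powr p"
    using xdag_close eps_bregman_ereal[OF fin[OF x\<^sub>0_dom] fin[OF xdag_dom(2)], of 0 \<xi>\<^sub>0]
    by (simp add: D_def x_init \<xi>_init)
  have close: "norm (xdag - z) \<le> \<rho>" if "c\<^sub>0 / 2 * norm (xdag - z) powr p \<le> 1 / 2 * c\<^sub>0 * \<rho> powr p" for z
  proof -
    have "norm (xdag - z) powr p \<le> \<rho> powr p" using that c\<^sub>0 by simp
    then show ?thesis using powr_less_mono2[OF p0, of \<rho> "norm (xdag - z)"] \<rho> by force
  qed
  have xdag_x\<^sub>0: "norm (xdag - x\<^sub>0) \<le> \<rho>"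
  proof (rule close)
    have "c\<^sub>0 / 2 * norm (xdag - x\<^sub>0) powr p \<le> D 0 xdag - \<epsilon> 0"
      using eps_subgradient_lower_bound[OF \<Theta>(3) \<xi>\<^sub>0 fin[OF x\<^sub>0_dom] fin[OF xdag_dom(2)]]
      by (simp add: D_def x_init \<xi>_init)
    moreover have "0 \<le> c\<^sub>0 * \<rho> powr p" using c\<^sub>0 by simp
    ultimately show "c\<^sub>0 / 2 * norm (xdag - x\<^sub>0) powr p \<le> 1 / 2 * c\<^sub>0 * \<rho> powr p"
      using D0 by linarith
  qed
  then have xdag_ball: "xdag \<in> cball x\<^sub>0 (2 * \<rho>)"
    using \<rho> by (simp add: dist_norm norm_minus_commute)

  have dual: "duality_map s (Y (n mod N)) (r n) \<in> duality_mapping s (Y (n mod N)) (r n)"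
      "r n \<in> Y (n mod N)" if ball: "x n \<in> cball x\<^sub>0 (2 * \<rho>)" for n
  proof -
    have i: "n mod N < N" using N by simp
    have V: "subspace (Y (n mod N))" using Y_banach[OF i] by simp
    have "x n \<in> Dom (n mod N)" using ball ball_dom i by blast
    then show rn: "r n \<in> Y (n mod N)"
      unfolding r_def by (intro subspace_diff[OF V] F_range i y\<delta>(1))
    show "duality_map s (Y (n mod N)) (r n) \<in> duality_mapping s (Y (n mod N)) (r n)"
      by (rule duality_map_in_duality_mapping[OF V Y_smooth[OF i] rn s])
  qed

  have \<mu>t: "0 \<le> \<mu>t n" "\<mu>t n \<le> \<beta>\<^sub>1" "\<mu>t n * norm (g n) powr p \<le> \<beta>\<^sub>0 * norm (r n) powr (p * (s - 1))" for n
  proof -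
    show "0 \<le> \<mu>t n" "\<mu>t n \<le> \<beta>\<^sub>1" using \<beta>\<^sub>0 \<beta>\<^sub>1 by (auto simp: \<mu>t_def)
    show "\<mu>t n * norm (g n) powr p \<le> \<beta>\<^sub>0 * norm (r n) powr (p * (s - 1))"
    proof (cases "norm (g n) powr p = 0")
      case True
      then show ?thesis using \<beta>\<^sub>0 by simp
    next
      case False
      then have "norm (g n) powr p > 0" by (metis powr_ge_zero order_le_less)
      moreover have "\<mu>t n \<le> \<beta>\<^sub>0 * norm (r n) powr (p * (s - 1)) / norm (g n) powr p"
        using False by (simp add: \<mu>t_def)
      ultimately show ?thesis by (simp add: pos_le_divide_eq)
    qed
  qed
  have w_nonneg: "w n \<ge> 0" for n
    using \<mu>t(1)[of n] \<sigma> \<epsilon>_nonneg[of n] by (simp add: w_def R_def)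

  have step: "D (Suc n) xh - D n xh \<le> 2 * \<epsilon> n + \<epsilon> (Suc n) - b * w n"
    if ball: "x n \<in> cball x\<^sub>0 (2 * \<rho>)" and xh: "xh \<in> cball x\<^sub>0 (2 * \<rho>)" "xh \<in> effective_domain \<Theta>"
      and sol: "\<And>i. i < N \<Longrightarrow> F i xh = y i" for n xh
  proof -
    define i where "i = n mod N"
    have i: "i < N" using N by (simp add: i_def)
    have V: "subspace (Y i)" using Y_banach[OF i] by simp
    define f where "f = duality_map s (Y i) (r n)"
    have f: "f \<in> duality_mapping s (Y i) (r n)" "r n \<in> Y i"
      using dual[OF ball] by (simp_all add: f_def i_def)
    have fd: "f \<in> dual_space (Y i)" using f by (simp add: duality_mapping_def)
    have g: "blinfun_apply (g n) h = f (blinfun_apply (L i (x n)) h)" for h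
      using adjoint_apply_dual(1)[OF V fd L_range[OF i ball]] by (simp add: g_def f_def i_def)
    define a where "a = norm (r n)"
    define k where "k = blinfun_apply (L i (x n)) (x n - xh)"
    have "norm (r n - k) \<le> \<gamma> * norm (r n) + (1 + \<gamma>) * \<delta>"
    proof -
      have "r n - k = (y i - y\<delta> i) - (F i xh - F i (x n) - blinfun_apply (L i (x n)) (xh - x n))"
        using sol[OF i] by (simp add: r_def k_def i_def blinfun.diff_right)
      then have "norm (r n - k) \<le> norm (y i - y\<delta> i)
          + norm (F i xh - F i (x n) - blinfun_apply (L i (x n)) (xh - x n))"
        by (simp add: norm_triangle_ineq4)
      also have "\<dots> \<le> \<delta> + \<gamma> * norm (F i xh - F i (x n))"
        using y\<delta>(2)[OF i] cone[OF i xh(1) ball] by (intro add_mono) (simp_all add: norm_minus_commute)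
      also have "\<dots> \<le> \<delta> + \<gamma> * (norm (r n) + \<delta>)"
      proof (intro add_left_mono mult_left_mono)
        have "F i xh - F i (x n) = - r n - (y\<delta> i - y i)"
          using sol[OF i] by (simp add: r_def i_def)
        then show "norm (F i xh - F i (x n)) \<le> norm (r n) + \<delta>"
          using norm_triangle_ineq4[of "- r n" "y\<delta> i - y i"] y\<delta>(2)[OF i] by simp
      qed (rule \<gamma>(1))
      finally show ?thesis by (simp add: algebra_simps)
    qed
    then have pair: "(1 - \<gamma>) * a powr s - (1 + \<gamma>) * \<delta> * a powr (s - 1) \<le> blinfun_apply (g n) (x n - xh)"
      unfolding g a_def
      by (intro duality_mapping_pairing[OF V f(1) f(2)]) (auto simp: k_def L_range[OF i ball])
    have \<mu>0: "\<mu> n \<ge> 0" using \<mu>t(1)[of n] by (simp add: \<mu>_def)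
    have up: "D (Suc n) xh - D n xh \<le> \<epsilon> n + \<epsilon> (Suc n) - \<mu> n * blinfun_apply (g n) (x n - xh)
        + \<mu> n * norm (g n) * norm (x (Suc n) - x n) - c\<^sub>0 / 2 * norm (x (Suc n) - x n) powr p"
      unfolding D_def \<xi>_step
      by (rule eps_bregman_step[OF \<Theta>(3)]) (use iter fin \<mu>0 in auto)
    show ?thesis
    proof (cases "R n > (\<tau> * \<delta>) powr p")
      case True
      have "\<mu> n * ((1 - \<gamma>) * a powr s - (1 + \<gamma>) * \<delta> * a powr (s - 1)) \<le> \<mu> n * blinfun_apply (g n) (x n - xh)"
        using pair \<mu>0 by (rule mult_left_mono)
      moreover have "\<mu> n = \<mu>t n * R n powr (1 - s / p)"
        using True by (simp add: \<mu>_def R_def)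
      moreover have "\<mu>t n * R n powr (1 - s / p) * ((1 + \<gamma>) * \<delta> * a powr (s - 1) - (1 - \<gamma>) * a powr s)
          + \<mu>t n * R n powr (1 - s / p) * norm (g n) * norm (x (Suc n) - x n)
          - c\<^sub>0 / 2 * norm (x (Suc n) - x n) powr p \<le> \<epsilon> n - b * (\<mu>t n * R n)"
        unfolding b_def
        by (rule landweber_step_decrease[OF p pstar c\<^sub>0 \<beta>\<^sub>0 s \<beta>(1) \<gamma> _ \<delta> \<sigma> \<kappa> \<kappa>\<sigma> \<mu>t(1,2) _ \<epsilon>_nonneg _ _ _ True])
          (use \<tau> \<mu>t(3) in \<open>auto simp: R_def a_def\<close>)
      ultimately show ?thesis using up True by (simp add: w_def algebra_simps)
    next
      case False
      then have "\<mu> n = 0" by (simp add: \<mu>_def R_def)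
      moreover have "0 \<le> c\<^sub>0 / 2 * norm (x (Suc n) - x n) powr p" using c\<^sub>0 by simp
      ultimately show ?thesis using up False \<epsilon>_nonneg[of n] by (simp add: w_def)
    qed
  qed

  \<comment> \<open>Besides \<open>1 / 4\<close>, the initial distance, the errors contribute \<open>3 / 16\<close>: each \<open>\<epsilon> k\<close> occurs at
    most three times, and \<open>1 / 4 + 3 / 16 = 7 / 16 < 1 / 2\<close> leaves \<open>x n\<close> within \<open>\<rho>\<close> of the solution.\<close>
  have accumulated: "c\<^sub>0 / 2 * norm (xdag - x n) powr p + b * (\<Sum>k<n. w k) \<le> 7 / 16 * c\<^sub>0 * \<rho> powr p"
    if "D n xdag + b * (\<Sum>k<n. w k) \<le> D 0 xdag + (\<Sum>k<n. 2 * \<epsilon> k + \<epsilon> (Suc k))" for n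
  proof -
    have "(\<Sum>k<Suc n. \<epsilon> k) \<le> suminf \<epsilon>"
      using \<epsilon>_sum(1) \<epsilon>_nonneg by (intro sum_le_suminf) auto
    then have 1: "16 * (\<Sum>k<Suc n. \<epsilon> k) \<le> c\<^sub>0 * \<rho> powr p" using \<epsilon>_sum(2) by linarith
    have 2: "\<epsilon> 0 + (\<Sum>k<n. \<epsilon> (Suc k)) = (\<Sum>k<Suc n. \<epsilon> k)"
      by (simp only: sum.lessThan_Suc_shift)
    have 3: "(\<Sum>k<n. \<epsilon> k) + \<epsilon> n = (\<Sum>k<Suc n. \<epsilon> k)" by simp
    have "(\<Sum>k<n. 2 * \<epsilon> k + \<epsilon> (Suc k)) = 2 * (\<Sum>k<n. \<epsilon> k) + (\<Sum>k<n. \<epsilon> (Suc k))"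
      by (simp add: sum.distrib sum_distrib_left)
    then have "c\<^sub>0 / 2 * norm (xdag - x n) powr p + b * (\<Sum>k<n. w k)
        \<le> 1 / 4 * c\<^sub>0 * \<rho> powr p + 3 * (\<Sum>k<Suc n. \<epsilon> k)"
      using D_lower[OF xdag_dom(2), of n] that D0 2 3 \<epsilon>_nonneg[of n] by linarith
    then show ?thesis using 1 by linarith
  qed
  have c\<rho>: "0 \<le> c\<^sub>0 * \<rho> powr p" using c\<^sub>0 by simp
  have in_ball: "x n \<in> cball x\<^sub>0 (2 * \<rho>)"
    if "D n xdag + b * (\<Sum>k<n. w k) \<le> D 0 xdag + (\<Sum>k<n. 2 * \<epsilon> k + \<epsilon> (Suc k))" for n
  proof -
    have "0 \<le> b * (\<Sum>k<n. w k)" using b w_nonneg by (simp add: sum_nonneg)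
    then have "c\<^sub>0 / 2 * norm (xdag - x n) powr p \<le> 1 / 2 * c\<^sub>0 * \<rho> powr p"
      using accumulated[OF that] c\<rho> by linarith
    then have "norm (xdag - x n) \<le> \<rho>" by (rule close)
    then show ?thesis
      using xdag_x\<^sub>0 norm_triangle_ineq[of "x\<^sub>0 - xdag" "xdag - x n"]
      by (simp add: dist_norm norm_minus_commute)
  qed
  \<comment> \<open>The descent estimate needs the current iterate in the ball, and the ball membership follows
    from the accumulated descent; one induction yields both.\<close>
  have total: "D n xdag + b * (\<Sum>k<n. w k) \<le> D 0 xdag + (\<Sum>k<n. 2 * \<epsilon> k + \<epsilon> (Suc k))" for n
  proof (induction n)
    case (Suc n)
    have "D (Suc n) xdag - D n xdag \<le> 2 * \<epsilon> n + \<epsilon> (Suc n) - b * w n"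
      by (rule step[OF in_ball[OF Suc] xdag_ball xdag_dom(2) xdag_sol])
    then show ?case using Suc by (simp add: distrib_left)
  qed simp
  note ball = in_ball[OF total]

  have "\<exists>m. \<forall>n\<ge>m. R n \<le> (\<tau> * \<delta>) powr p"
  proof -
    define B where "B = 1 + 3 * (1 + \<gamma>) / (1 - \<gamma>) * (\<Sum>i<N. norm (L i x\<^sub>0))"
    have B: "B > 0"
      unfolding B_def using \<gamma> by (intro add_pos_nonneg mult_nonneg_nonneg sum_nonneg) auto
    have LB: "norm (L i (x n)) \<le> B" if i: "i < N" for i n
    proof -
      have "norm (L i (x n)) \<le> 3 * (1 + \<gamma>) / (1 - \<gamma>) * norm (L i x\<^sub>0)"
        using \<rho> by (intro tangential_cone_bounded_derivative[OF _ \<gamma> cone[OF i] ball]) auto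
      also have "\<dots> \<le> 3 * (1 + \<gamma>) / (1 - \<gamma>) * (\<Sum>i<N. norm (L i x\<^sub>0))"
        using \<gamma> i by (intro mult_left_mono member_le_sum) auto
      finally show ?thesis by (simp add: B_def)
    qed
    have gB: "norm (g n) powr p \<le> B powr p * norm (r n) powr (p * (s - 1))" for n
    proof -
      define i where "i = n mod N"
      have i: "i < N" using N by (simp add: i_def)
      have V: "subspace (Y i)" using Y_banach[OF i] by simp
      have f: "duality_map s (Y i) (r n) \<in> duality_mapping s (Y i) (r n)"
        using dual(1)[OF ball] by (simp add: i_def)
      have "norm (g n) \<le> norm (r n) powr (s - 1) * norm (L i (x n))"
        using adjoint_apply_dual(2)[OF V _ L_range[OF i ball], of "duality_map s (Y i) (r n)"] f
        by (simp add: g_def i_def duality_mapping_def)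
      also have "\<dots> \<le> norm (r n) powr (s - 1) * B" using LB[OF i] by (intro mult_left_mono) auto
      finally have "norm (g n) powr p \<le> (norm (r n) powr (s - 1) * B) powr p"
        using p0 by (intro powr_mono2) auto
      then show ?thesis by (simp add: powr_mult powr_powr mult.commute)
    qed
    \<comment> \<open>The minimum that defines \<open>\<mu>t\<close> stays away from zero because \<open>g n\<close> is bounded by a multiple of
      \<open>norm (r n) powr (s - 1)\<close>.\<close>
    define c where "c = min (\<beta>\<^sub>0 / B powr p) \<beta>\<^sub>1"
    have c: "c > 0" using \<beta>\<^sub>0 \<beta>\<^sub>1 B by (simp add: c_def)
    have cm: "c \<le> \<mu>t n" for n
    proof (cases "norm (g n) powr p = 0")
      case False
      then have gp: "norm (g n) powr p > 0" by (metis powr_ge_zero order_le_less)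
      have "\<beta>\<^sub>0 * norm (g n) powr p \<le> \<beta>\<^sub>0 * (B powr p * norm (r n) powr (p * (s - 1)))"
        using gB \<beta>\<^sub>0 by (intro mult_left_mono) auto
      then have "\<beta>\<^sub>0 / B powr p \<le> \<beta>\<^sub>0 * norm (r n) powr (p * (s - 1)) / norm (g n) powr p"
        using gp B by (simp add: field_simps)
      then show ?thesis using False by (auto simp: \<mu>t_def c_def)
    qed (simp add: \<mu>t_def c_def)
    have w_lower: "c * (\<tau> * \<delta>) powr p \<le> w n" if "R n > (\<tau> * \<delta>) powr p" for n
      using that cm[of n] c by (simp add: w_def mult_mono)
    \<comment> \<open>A step that is not skipped has a decrease bounded below, while the decreases are summable;
      so all late steps are skipped.\<close>
    have "(\<Sum>k<n. w k) \<le> 7 / 16 * c\<^sub>0 * \<rho> powr p / b" for n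
    proof -
      have "0 \<le> c\<^sub>0 / 2 * norm (xdag - x n) powr p" using c\<^sub>0 by simp
      then have "b * (\<Sum>k<n. w k) \<le> 7 / 16 * c\<^sub>0 * \<rho> powr p"
        using accumulated[OF total, of n] by linarith
      then show ?thesis using b by (simp add: field_simps)
    qed
    then have "summable w" using w_nonneg by (intro summableI_nonneg_bounded)
    then have "w \<longlonglongrightarrow> 0" by (rule summable_LIMSEQ_zero)
    moreover have "c * (\<tau> * \<delta>) powr p > 0" using c \<tau> \<delta> by simp
    ultimately have "\<forall>\<^sub>F n in sequentially. w n < c * (\<tau> * \<delta>) powr p"
      by (rule order_tendstoD)
    then obtain m where "\<And>n. n \<ge> m \<Longrightarrow> w n < c * (\<tau> * \<delta>) powr p"
      by (auto simp: eventually_sequentially)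
    then have "R n \<le> (\<tau> * \<delta>) powr p" if "n \<ge> m" for n
      using w_lower[of n] that by (meson not_less)
    then show ?thesis by blast
  qed
  then obtain m where m: "\<And>n. n \<ge> m \<Longrightarrow> norm (r n) powr p + \<sigma> * \<epsilon> n \<le> (\<tau> * \<delta>) powr p"
    unfolding R_def by blast
  have "\<exists>n. q n = N" by (rule consecutive_count_reaches[OF q_def N m])
  then have stops: "\<exists>n\<^sub>\<delta>. q n\<^sub>\<delta> = N \<and> (\<forall>m<n\<^sub>\<delta>. q m \<noteq> N)"
    using exists_least_iff[of "\<lambda>n. q n = N"] by blast

  show ?thesis
  proof (intro conjI allI impI)
    show "x n \<in> cball x\<^sub>0 (2 * \<rho>) \<inter> effective_domain \<Theta>" for n
      using ball iter by blast
    show "\<exists>n\<^sub>\<delta>. q n\<^sub>\<delta> = N \<and> (\<forall>m<n\<^sub>\<delta>. q m \<noteq> N)" by (rule stops)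
    fix xh n
    assume xh: "xh \<in> cball x\<^sub>0 (2 * \<rho>) \<inter> effective_domain \<Theta> \<and> (\<forall>i<N. F i xh = y i)"
    then have "D (Suc n) xh - D n xh \<le> 2 * \<epsilon> n + \<epsilon> (Suc n) - b * w n"
      by (intro step ball) auto
    also have "\<dots> \<le> 2 * \<epsilon> n + \<epsilon> (Suc n)"
      using b w_nonneg[of n] by simp
    finally show "eps_bregman (\<epsilon> (Suc n)) (\<xi> (Suc n)) \<Theta> xh (x (Suc n))
        - eps_bregman (\<epsilon> n) (\<xi> n) \<Theta> xh (x n) \<le> ereal (2 * \<epsilon> n + \<epsilon> (Suc n))"
      using xh by (simp add: D_bregman)
  qed
qed

end
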